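(* Let $A=(a_{i,j})_{i,j\in[1,r]}$ be a Cartan matrix of type $A_n$ ($n\ge2$), $D_{2n+1}$ ($n\geq2$), or $E_6$, with index set $[1,r]$ labelled arbitrarily, let $c=s_1s_2\cdots s_r$, and let $h$ be the Coxeter number. Then for every $i\in[1,r]$, $$h(i;c)=m_i,\qquad\text{where } m_i=\tfrac12(h+a_i-b_i).$$
   Context: $[1,r]=\{1,\dots,r\}$. $A$ is the Cartan matrix, $a_{i,j}=\alpha_i^\vee(\alpha_j)$, of a root system with simple roots $\alpha_1,\dots,\alpha_r$, simple coroots $\alpha_i^\vee$, fundamental weights $\omega_1,\dots,\omega_r$, Weyl group $W$ with simple reflections $s_i$ and longest element $w_0$; $h$ is the order of $c$. For $i\in[1,r]$, $i^*\in[1,r]$ is defined by $w_0\omega_i=-\omega_{i^*}$ (in these types $i\mapsto i^*$ is induced by the non-trivial automorphism of the Dynkin diagram), and $h(i;c)\ge1$ is the integer such that $\omega_i>c\omega_i>\cdots>c^{h(i;c)}\omega_i=-\omega_{i^*}$, where $\delta>\gamma$ means that $\delta\ne\gamma$ and $\delta-\gamma$ is a non-negative integral combination of simple roots. For $i,j\in[1,r]$ write $i\prec_cj$ if $i<j$ and $a_{i,j}\ne0$. For $i\in[1,r]$, let $i=i_0-i_1-\cdots-i_{l-1}-i_l=i^*$ be the unique path in the Dynkin diagram connecting $i$ to $i^*$ ($l\ge0$ the number of edges). If $i=i^*$ set $a_i=b_i=0$; if $i\ne i^*$ set $$a_i=\#\{j\in[0,l-1]:i_j\prec_ci_{j+1}\},\qquad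 b_i=\#\{j\in[0,l-1]:i_{j+1}\prec_ci_j\}.$$ *)

theory Defs
  imports "HOL-Analysis.Analysis"
begin

text \<open>Coroots are realised as vectors, via the inner product: the value
  \<open>\<beta>\<^sup>\<or>(v)\<close> is \<open>coroot \<beta> \<bullet> v\<close>.\<close>

definition coroot :: "'a::euclidean_space \<Rightarrow> 'a" where
  "coroot \<beta> = (2 / (\<beta> \<bullet> \<beta>)) *\<^sub>R \<beta>"

definition refl_along :: "'a::euclidean_space \<Rightarrow> 'a \<Rightarrow> 'a" where
  "refl_along \<beta> v = v - (coroot \<beta> \<bullet> v) *\<^sub>R \<beta>"

definition root_system :: "'a::euclidean_space set \<Rightarrow> bool" where
  "root_system \<Phi> \<longleftrightarrow>
     finite \<Phi> \<and> 0 \<notin> \<Phi> \<and> span \<Phi> = UNIV \<and>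
     (\<forall>\<beta>\<in>\<Phi>. refl_along \<beta> ` \<Phi> = \<Phi>) \<and>
     (\<forall>\<beta>\<in>\<Phi>. \<forall>\<gamma>\<in>\<Phi>. coroot \<beta> \<bullet> \<gamma> \<in> \<int>) \<and>
     (\<forall>\<beta>\<in>\<Phi>. \<forall>t. t *\<^sub>R \<beta> \<in> \<Phi> \<longrightarrow> t = 1 \<or> t = -1)"

definition nonneg_comb :: "nat \<Rightarrow> (nat \<Rightarrow> 'a::euclidean_space) \<Rightarrow> 'a \<Rightarrow> bool" where
  "nonneg_comb r \<alpha> v \<longleftrightarrow> (\<exists>k :: nat \<Rightarrow> nat. v = (\<Sum>i\<in>{1..r}. real (k i) *\<^sub>R \<alpha> i))"

definition simple_system ::
    "'a::euclidean_space set \<Rightarrow> nat \<Rightarrow> (nat \<Rightarrow> 'a) \<Rightarrow> bool" where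
  "simple_system \<Phi> r \<alpha> \<longleftrightarrow>
     inj_on \<alpha> {1..r} \<and> \<alpha> ` {1..r} \<subseteq> \<Phi> \<and> independent (\<alpha> ` {1..r}) \<and>
     (\<forall>\<beta>\<in>\<Phi>. nonneg_comb r \<alpha> \<beta> \<or> nonneg_comb r \<alpha> (- \<beta>))"

definition cartan_matrix_of ::
    "nat \<Rightarrow> (nat \<Rightarrow> 'a::euclidean_space) \<Rightarrow> (nat \<Rightarrow> nat \<Rightarrow> int) \<Rightarrow> bool" where
  "cartan_matrix_of r \<alpha> A \<longleftrightarrow>
     (\<forall>i\<in>{1..r}. \<forall>j\<in>{1..r}. real_of_int (A i j) = coroot (\<alpha> i) \<bullet> \<alpha> j)"

definition fund_weight :: "nat \<Rightarrow> (nat \<Rightarrow> 'a::euclidean_space) \<Rightarrow> nat \<Rightarrow> 'a" where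
  "fund_weight r \<alpha> i =
     (THE v. \<forall>j\<in>{1..r}. coroot (\<alpha> j) \<bullet> v = (if j = i then 1 else 0))"

text \<open>\<open>\<delta> > \<gamma>\<close> in the root order is written \<open>root_less r \<alpha> \<gamma> \<delta>\<close>.\<close>

definition root_less ::
    "nat \<Rightarrow> (nat \<Rightarrow> 'a::euclidean_space) \<Rightarrow> 'a \<Rightarrow> 'a \<Rightarrow> bool" where
  "root_less r \<alpha> \<gamma> \<delta> \<longleftrightarrow> \<delta> \<noteq> \<gamma> \<and> nonneg_comb r \<alpha> (\<delta> - \<gamma>)"

definition word_prod :: "(nat \<Rightarrow> 'a::euclidean_space) \<Rightarrow> nat list \<Rightarrow> 'a \<Rightarrow> 'a" where
  "word_prod \<alpha> is = foldr (\<lambda>i f. refl_along (\<alpha> i) \<circ> f) is id"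

text \<open>Simple reflections are involutions, so the group they generate
  consists of the products of words in them.\<close>

definition weyl_group :: "nat \<Rightarrow> (nat \<Rightarrow> 'a::euclidean_space) \<Rightarrow> ('a \<Rightarrow> 'a) set" where
  "weyl_group r \<alpha> = word_prod \<alpha> ` lists {1..r}"

definition weyl_length ::
    "nat \<Rightarrow> (nat \<Rightarrow> 'a::euclidean_space) \<Rightarrow> ('a \<Rightarrow> 'a) \<Rightarrow> nat" where
  "weyl_length r \<alpha> w =
     (LEAST k. \<exists>is\<in>lists {1..r}. length is = k \<and> word_prod \<alpha> is = w)"

definition longest_element :: "nat \<Rightarrow> (nat \<Rightarrow> 'a::euclidean_space) \<Rightarrow> 'a \<Rightarrow> 'a" where
  "longest_element r \<alpha> =
     (THE w. w \<in> weyl_group r \<alpha> \<and>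
             (\<forall>u\<in>weyl_group r \<alpha>. weyl_length r \<alpha> u \<le> weyl_length r \<alpha> w))"

definition coxeter_element :: "nat \<Rightarrow> (nat \<Rightarrow> 'a::euclidean_space) \<Rightarrow> 'a \<Rightarrow> 'a" where
  "coxeter_element r \<alpha> = word_prod \<alpha> [1..<Suc r]"

definition coxeter_number :: "nat \<Rightarrow> (nat \<Rightarrow> 'a::euclidean_space) \<Rightarrow> nat" where
  "coxeter_number r \<alpha> = (LEAST k. k > 0 \<and> coxeter_element r \<alpha> ^^ k = id)"

text \<open>\<open>star r \<alpha> i\<close> is \<open>i\<^sup>*\<close>.\<close>

definition star :: "nat \<Rightarrow> (nat \<Rightarrow> 'a::euclidean_space) \<Rightarrow> nat \<Rightarrow> nat" where
  "star r \<alpha> i =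
     (THE j. j \<in> {1..r} \<and> longest_element r \<alpha> (fund_weight r \<alpha> i) = - fund_weight r \<alpha> j)"

text \<open>The number \<open>h(i;c)\<close>; a strictly decreasing chain takes the value
  \<open>-\<omega>\<^sub>j\<close> with \<open>j = i\<^sup>*\<close> at most once, so \<open>THE\<close> picks a unique \<open>m\<close>.\<close>

definition weight_chain_length ::
    "nat \<Rightarrow> (nat \<Rightarrow> 'a::euclidean_space) \<Rightarrow> nat \<Rightarrow> nat" where
  "weight_chain_length r \<alpha> i =
     (let c = coxeter_element r \<alpha>; \<omega> = fund_weight r \<alpha> in
      THE m. m \<ge> 1 \<and>
        (\<forall>k<m. root_less r \<alpha> ((c ^^ Suc k) (\<omega> i)) ((c ^^ k) (\<omega> i))) \<and>
        (c ^^ m) (\<omega> i) = - \<omega> (star r \<alpha> i))"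

text \<open>Only the entries with both indices in the relevant interval
  \<open>{1..r}\<close> are meaningful.\<close>

definition simply_laced_matrix :: "(nat \<times> nat) set \<Rightarrow> nat \<Rightarrow> nat \<Rightarrow> int" where
  "simply_laced_matrix E i j =
     (if i = j then 2 else if (i, j) \<in> E \<or> (j, i) \<in> E then -1 else 0)"

definition cartan_A :: "nat \<Rightarrow> nat \<Rightarrow> nat \<Rightarrow> int" where
  "cartan_A n = simply_laced_matrix {(i, Suc i) | i. 1 \<le> i \<and> i < n}"

definition cartan_D :: "nat \<Rightarrow> nat \<Rightarrow> nat \<Rightarrow> int" where
  "cartan_D n = simply_laced_matrix
     ({(i, Suc i) | i. 1 \<le> i \<and> Suc i < n} \<union> {(n - 2, n)})"

definition cartan_E6 :: "nat \<Rightarrow> nat \<Rightarrow> int" where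
  "cartan_E6 = simply_laced_matrix {(1, 3), (3, 4), (4, 5), (5, 6), (2, 4)}"

definition same_up_to_labelling ::
    "nat \<Rightarrow> (nat \<Rightarrow> nat \<Rightarrow> int) \<Rightarrow> (nat \<Rightarrow> nat \<Rightarrow> int) \<Rightarrow> bool" where
  "same_up_to_labelling r A B \<longleftrightarrow>
     (\<exists>\<sigma>. bij_betw \<sigma> {1..r} {1..r} \<and>
          (\<forall>i\<in>{1..r}. \<forall>j\<in>{1..r}. A i j = B (\<sigma> i) (\<sigma> j)))"

definition type_A :: "nat \<Rightarrow> nat \<Rightarrow> (nat \<Rightarrow> nat \<Rightarrow> int) \<Rightarrow> bool" where
  "type_A n r A \<longleftrightarrow> r = n \<and> same_up_to_labelling r A (cartan_A n)"

definition type_D :: "nat \<Rightarrow> nat \<Rightarrow> (nat \<Rightarrow> nat \<Rightarrow> int) \<Rightarrow> bool" where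
  "type_D n r A \<longleftrightarrow> r = n \<and> same_up_to_labelling r A (cartan_D n)"

definition type_E6 :: "nat \<Rightarrow> (nat \<Rightarrow> nat \<Rightarrow> int) \<Rightarrow> bool" where
  "type_E6 r A \<longleftrightarrow> r = 6 \<and> same_up_to_labelling r A cartan_E6"

definition cox_prec :: "(nat \<Rightarrow> nat \<Rightarrow> int) \<Rightarrow> nat \<Rightarrow> nat \<Rightarrow> bool" where
  "cox_prec A i j \<longleftrightarrow> i < j \<and> A i j \<noteq> 0"

text \<open>A path is given by the list of its vertices, which are pairwise distinct.\<close>

definition dynkin_path ::
    "nat \<Rightarrow> (nat \<Rightarrow> nat \<Rightarrow> int) \<Rightarrow> nat \<Rightarrow> nat \<Rightarrow> nat list \<Rightarrow> bool" where
  "dynkin_path r A i j p \<longleftrightarrow>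
     p \<noteq> [] \<and> hd p = i \<and> last p = j \<and> set p \<subseteq> {1..r} \<and> distinct p \<and>
     (\<forall>k. Suc k < length p \<longrightarrow> A (p ! k) (p ! Suc k) \<noteq> 0)"

definition star_path ::
    "nat \<Rightarrow> (nat \<Rightarrow> 'a::euclidean_space) \<Rightarrow> (nat \<Rightarrow> nat \<Rightarrow> int) \<Rightarrow> nat \<Rightarrow> nat list" where
  "star_path r \<alpha> A i = (THE p. dynkin_path r A i (star r \<alpha> i) p)"

definition a_count ::
    "nat \<Rightarrow> (nat \<Rightarrow> 'a::euclidean_space) \<Rightarrow> (nat \<Rightarrow> nat \<Rightarrow> int) \<Rightarrow> nat \<Rightarrow> nat" where
  "a_count r \<alpha> A i =
     (if star r \<alpha> i = i then 0
      else let p = star_path r \<alpha> A i in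
        card {j. Suc j < length p \<and> cox_prec A (p ! j) (p ! Suc j)})"

definition b_count ::
    "nat \<Rightarrow> (nat \<Rightarrow> 'a::euclidean_space) \<Rightarrow> (nat \<Rightarrow> nat \<Rightarrow> int) \<Rightarrow> nat \<Rightarrow> nat" where
  "b_count r \<alpha> A i =
     (if star r \<alpha> i = i then 0
      else let p = star_path r \<alpha> A i in
        card {j. Suc j < length p \<and> cox_prec A (p ! Suc j) (p ! j)})"

end

theory Submission
  imports Defs
begin

text \<open>Choose heights with \<open>\<xi> j = \<xi> i + 1\<close> whenever \<open>i \<prec>\<^sub>c j\<close>. The vectors
  \<open>Y i (\<xi> i + 2 k) = c\<^sup>k \<omega>\<^sub>i\<close> then satisfy the discrete wave equation
  \<open>Y i t + Y i (t + 2) = \<Sum> Y j (t + 1)\<close> (sum over the neighbours \<open>j\<close> of \<open>i\<close>), in which the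
  orientation has disappeared. Every solution of this equation on the Dynkin diagram satisfies
  \<open>Y i (t + h) = - Y (i\<^sup>*) t\<close>: in type \<open>A\<close> this is the d'Alembert reflection principle with
  Dirichlet ends, and the types \<open>D\<close> and \<open>E\<^sub>6\<close> unfold to type \<open>A\<close>. At \<open>t = \<xi> (i\<^sup>*)\<close> it says that
  \<open>c\<close> takes \<open>\<omega>\<^sub>i\<close> to \<open>- \<omega>\<^sub>i\<^sub>*\<close> in \<open>(h + \<xi> (i\<^sup>*) - \<xi> i) / 2\<close> steps, and \<open>\<xi> (i\<^sup>*) - \<xi> i\<close> telescopes
  to \<open>a\<^sub>i - b\<^sub>i\<close> along the path. That all steps are descents, and that \<open>c\<close> has order exactly \<open>h\<close>,
  follows from an eigenvector of \<open>c\<close> for \<open>exp (2\<pi>\<i>/h)\<close> that does not vanish on any \<open>\<omega>\<^sub>i\<close>.\<close>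

text \<open>The half period yields only some diagram involution \<open>\<tau>\<close>, whereas
  \<open>star\<close> is defined through the longest element, itself a \<open>THE\<close> over word
  lengths. Hence enough Weyl group theory is developed to recognise that element by its negating the
  simple roots up to a permutation; a word acting in this way is then extracted from the wave
  itself, and so \<open>\<tau>\<close> is identified with \<open>star\<close>. The eigenvector
  supplies what periodicity alone cannot: the relation that the h-th power of c is the identity only
  bounds periods from above, while the eigenvector shows that each single \<omega>_i has period
  exactly h. This excludes that an orbit meets some -\<omega>_j too early, and such a meeting is
  what a failure of descent would produce. Being a tree matters twice: paths are unique, and an
  arbitrary orientation integrates to a height function. Heights change by at most r - 1 < h along a
  path, which keeps the number of steps positive.\<close>

declare One_nat_def [simp del]

section \<open>Root systems and their Weyl groups\<close>

lemma coroot_self: "\<beta> \<noteq> 0 \<Longrightarrow> coroot \<beta> \<bullet> \<beta> = 2"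
  by (simp add: coroot_def)

lemma linear_refl_along: "linear (refl_along \<beta>)"
  by (rule linearI) (simp_all add: refl_along_def inner_add_right algebra_simps)

lemma refl_along_refl_along [simp]: "refl_along \<beta> (refl_along \<beta> v) = v"
proof (cases "\<beta> = 0")
  case False
  then show ?thesis
    by (simp add: refl_along_def inner_diff_right coroot_self)
qed (simp add: refl_along_def)

lemma refl_along_self: "\<beta> \<noteq> 0 \<Longrightarrow> refl_along \<beta> \<beta> = - \<beta>"
  by (simp add: refl_along_def coroot_self scaleR_2)

lemma inner_refl_along [simp]: "refl_along \<beta> x \<bullet> refl_along \<beta> y = x \<bullet> y"
proof (cases "\<beta> = 0")
  case False
  then show ?thesis
    by (simp add: refl_along_def coroot_def inner_diff_left inner_diff_right inner_commute
        field_simps)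
qed (simp add: refl_along_def)

lemma refl_along_conjugate:
  assumes "linear g" "\<And>x y. g x \<bullet> g y = x \<bullet> y"
  shows "g (refl_along \<beta> v) = refl_along (g \<beta>) (g v)"
  using assms by (simp add: refl_along_def coroot_def linear_diff linear_scale)

lemma word_prod_Nil [simp]: "word_prod \<alpha> [] = id"
  and word_prod_Cons [simp]: "word_prod \<alpha> (i # ws) = refl_along (\<alpha> i) \<circ> word_prod \<alpha> ws"
  by (simp_all add: word_prod_def)

lemma word_prod_append [simp]: "word_prod \<alpha> (ws @ js) = word_prod \<alpha> ws \<circ> word_prod \<alpha> js"
  by (induction ws) (auto simp: comp_assoc)

lemma word_prod_rev_cancel [simp]: "word_prod \<alpha> (rev ws) (word_prod \<alpha> ws x) = x"
  by (induction ws arbitrary: x) auto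

lemma word_prod_cancel_rev [simp]: "word_prod \<alpha> ws (word_prod \<alpha> (rev ws) x) = x"
  using word_prod_rev_cancel[of \<alpha> "rev ws" x] by simp

lemma linear_word_prod: "linear (word_prod \<alpha> ws)"
proof (induction ws)
  case (Cons i ws)
  then show ?case
    unfolding word_prod_Cons by (rule linear_compose[OF _ linear_refl_along])
qed (simp add: linear_iff)

lemmas word_prod_minus = linear_neg[OF linear_word_prod]
  and word_prod_diff = linear_diff[OF linear_word_prod]
  and word_prod_sum = linear_sum[OF linear_word_prod]
  and word_prod_scale = linear_scale[OF linear_word_prod]

lemma inner_word_prod [simp]: "word_prod \<alpha> ws x \<bullet> word_prod \<alpha> ws y = x \<bullet> y"
  by (induction ws) auto

lemma inner_word_prod_left: "word_prod \<alpha> ws x \<bullet> y = x \<bullet> word_prod \<alpha> (rev ws) y"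
  using inner_word_prod[of \<alpha> ws x "word_prod \<alpha> (rev ws) y"] by simp

locale based_root_system =
  fixes \<Phi> :: "'a::euclidean_space set" and r :: nat and \<alpha> :: "nat \<Rightarrow> 'a"
  assumes root: "root_system \<Phi>" and simple: "simple_system \<Phi> r \<alpha>"
begin

abbreviation s :: "nat \<Rightarrow> 'a \<Rightarrow> 'a" where "s i \<equiv> refl_along (\<alpha> i)"
abbreviation \<omega> :: "nat \<Rightarrow> 'a" where "\<omega> \<equiv> fund_weight r \<alpha>"
abbreviation W :: "('a \<Rightarrow> 'a) set" where "W \<equiv> weyl_group r \<alpha>"

section \<open>Fundamental weights as the basis dual to the simple coroots\<close>

lemma simple_in: "i \<in> {1..r} \<Longrightarrow> \<alpha> i \<in> \<Phi>"
  using simple by (auto simp: simple_system_def)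

lemma root_nonzero: "\<beta> \<in> \<Phi> \<Longrightarrow> \<beta> \<noteq> 0"
  using root by (auto simp: root_system_def)

lemma simple_nonzero: "i \<in> {1..r} \<Longrightarrow> \<alpha> i \<noteq> 0"
  using simple_in root_nonzero by blast

lemma word_prod_root: "set ws \<subseteq> {1..r} \<Longrightarrow> \<beta> \<in> \<Phi> \<Longrightarrow> word_prod \<alpha> ws \<beta> \<in> \<Phi>"
proof (induction ws)
  case (Cons i ws)
  then have "s i ` \<Phi> = \<Phi>"
    using root simple_in by (auto simp: root_system_def)
  with Cons show ?case by auto
qed simp

lemma span_simple: "span (\<alpha> ` {1..r}) = UNIV"
proof -
  have "\<beta> \<in> span (\<alpha> ` {1..r})" if "\<beta> \<in> \<Phi>" for \<beta>
  proof -
    have *: "v \<in> span (\<alpha> ` {1..r})" if "nonneg_comb r \<alpha> v" for v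
      using that unfolding nonneg_comb_def by (auto intro!: span_sum span_scale intro: span_base)
    from that simple have "nonneg_comb r \<alpha> \<beta> \<or> nonneg_comb r \<alpha> (- \<beta>)"
      by (auto simp: simple_system_def)
    then show ?thesis
      using * span_neg[of "- \<beta>"] by fastforce
  qed
  then have "span \<Phi> \<subseteq> span (\<alpha> ` {1..r})"
    by (simp add: span_minimal subsetI)
  then show ?thesis
    using root by (auto simp: root_system_def)
qed

lemma eq_if_inner_simple:
  assumes "\<And>i. i \<in> {1..r} \<Longrightarrow> \<alpha> i \<bullet> x = \<alpha> i \<bullet> y"
  shows "x = y"
proof -
  have "linear (\<lambda>u. u \<bullet> x)" "linear (\<lambda>u. u \<bullet> y)"
    by (auto intro: bounded_linear.linear bounded_linear_inner_left)
  from linear_eq_on_span[OF this, of "\<alpha> ` {1..r}"] have "u \<bullet> x = u \<bullet> y" for u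
    unfolding span_simple using assms by blast
  then show ?thesis using vector_eq_ldot[of x y] by blast
qed

text \<open>Discharges the \<open>THE\<close> in \<open>fund_weight\<close>; uniqueness is
  \<open>eq_if_inner_simple\<close>, because the simple roots span.\<close>

lemma coroot_fund_weight:
  assumes "i \<in> {1..r}" "j \<in> {1..r}"
  shows "coroot (\<alpha> j) \<bullet> \<omega> i = (if j = i then 1 else 0)"
proof -
  from simple have ind: "independent (\<alpha> ` {1..r})" and inj: "inj_on \<alpha> {1..r}"
    by (auto simp: simple_system_def)
  \<comment> \<open>The Riesz vector \<open>adjoint f 1\<close> of this functional is the witness;
    half the squared length compensates the normalisation of the coroot.\<close>
  define f where "f = construct (\<alpha> ` {1..r}) (\<lambda>x. if x = \<alpha> i then (\<alpha> i \<bullet> \<alpha> i) / 2 else 0)"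
  have f: "linear f" "\<And>j. j \<in> {1..r} \<Longrightarrow> f (\<alpha> j) = (if j = i then (\<alpha> i \<bullet> \<alpha> i) / 2 else 0)"
    using ind inj assms(1) unfolding f_def
    by (auto simp: linear_construct construct_basis inj_on_eq_iff)
  define w where "w = adjoint f 1"
  have w: "coroot (\<alpha> j) \<bullet> w = (if j = i then 1 else 0)" if "j \<in> {1..r}" for j
    using f(2)[OF that] adjoint_works[OF f(1), of "\<alpha> j" 1] that simple_nonzero
    by (auto simp: w_def coroot_def)
  have "w' = w" if w': "\<forall>j\<in>{1..r}. coroot (\<alpha> j) \<bullet> w' = (if j = i then 1 else 0)" for w'
  proof (rule eq_if_inner_simple)
    fix j assume j: "j \<in> {1..r}"
    then have "coroot (\<alpha> j) \<bullet> w' = coroot (\<alpha> j) \<bullet> w" using w w' by auto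
    then show "\<alpha> j \<bullet> w' = \<alpha> j \<bullet> w"
      using simple_nonzero[OF j] by (auto simp: coroot_def)
  qed
  then have "\<omega> i = w"
    unfolding fund_weight_def using w by (intro the_equality) auto
  then show ?thesis using w assms by simp
qed

lemma expand_fund_weight: "x = (\<Sum>i\<in>{1..r}. (coroot (\<alpha> i) \<bullet> x) *\<^sub>R \<omega> i)"
proof (rule eq_if_inner_simple)
  fix j assume j: "j \<in> {1..r}"
  have "coroot (\<alpha> j) \<bullet> (\<Sum>i\<in>{1..r}. (coroot (\<alpha> i) \<bullet> x) *\<^sub>R \<omega> i)
      = (\<Sum>i\<in>{1..r}. (coroot (\<alpha> i) \<bullet> x) * (if j = i then 1 else 0))"
    using j by (simp add: inner_sum_right coroot_fund_weight)
  also have "\<dots> = coroot (\<alpha> j) \<bullet> x" using j by (simp add: if_distrib sum.delta cong: if_cong)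
  finally show "\<alpha> j \<bullet> x = \<alpha> j \<bullet> (\<Sum>i\<in>{1..r}. (coroot (\<alpha> i) \<bullet> x) *\<^sub>R \<omega> i)"
    using simple_nonzero[OF j] by (auto simp: coroot_def)
qed

lemma linear_eq_on_fund_weights:
  fixes f g :: "'a \<Rightarrow> 'b::real_vector"
  assumes "linear f" "linear g" "\<And>i. i \<in> {1..r} \<Longrightarrow> f (\<omega> i) = g (\<omega> i)"
  shows "f = g"
proof
  fix x
  show "f x = g x"
    using assms by (subst (1 2) expand_fund_weight) (simp add: linear_sum linear_scale)
qed

lemma fund_weight_inner_simple:
  assumes "i \<in> {1..r}" "j \<in> {1..r}"
  shows "\<omega> i \<bullet> \<alpha> j = (if j = i then (\<alpha> i \<bullet> \<alpha> i) / 2 else 0)"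
  using coroot_fund_weight[OF assms] simple_nonzero assms
  by (auto simp: coroot_def inner_commute field_simps split: if_splits)

lemma eq_if_inner_fund_weight:
  assumes "\<And>i. i \<in> {1..r} \<Longrightarrow> \<omega> i \<bullet> x = \<omega> i \<bullet> y"
  shows "x = y"
proof -
  have "linear (\<lambda>u. u \<bullet> x)" "linear (\<lambda>u. u \<bullet> y)"
    by (auto intro: bounded_linear.linear bounded_linear_inner_left)
  then have "(\<lambda>u. u \<bullet> x) = (\<lambda>u. u \<bullet> y)"
    using assms by (intro linear_eq_on_fund_weights)
  then show ?thesis by (metis vector_eq_ldot)
qed

lemma fund_weight_inj: "i \<in> {1..r} \<Longrightarrow> j \<in> {1..r} \<Longrightarrow> \<omega> i = \<omega> j \<Longrightarrow> i = j"
  using coroot_fund_weight[of i i] coroot_fund_weight[of j i] by (auto split: if_splits)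

lemma fund_weight_nonzero: "i \<in> {1..r} \<Longrightarrow> \<omega> i \<noteq> 0"
  using coroot_fund_weight[of i i] by auto

lemma refl_fund_weight:
  assumes "i \<in> {1..r}" "j \<in> {1..r}"
  shows "s j (\<omega> i) = (if j = i then \<omega> i - \<alpha> i else \<omega> i)"
  using coroot_fund_weight[OF assms] by (simp add: refl_along_def)

lemma word_prod_fix_fund_weight:
  assumes "set ws \<subseteq> {1..r}" "i \<in> {1..r}" "i \<notin> set ws"
  shows "word_prod \<alpha> ws (\<omega> i) = \<omega> i"
  using assms by (induction ws) (auto simp: refl_fund_weight)

text \<open>Pairing with fundamental weights is, up to positive scalars, taking coefficients in the simple
  roots.\<close>

definition pos :: "'a \<Rightarrow> bool" where
  "pos v \<longleftrightarrow> (\<forall>i\<in>{1..r}. 0 \<le> \<omega> i \<bullet> v)"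

lemma pos_nonneg_comb: "nonneg_comb r \<alpha> v \<Longrightarrow> pos v"
  by (auto simp: nonneg_comb_def pos_def inner_sum_right fund_weight_inner_simple
      intro!: sum_nonneg)

lemma pos_antisym: "pos v \<Longrightarrow> pos (- v) \<Longrightarrow> v = 0"
  by (rule eq_if_inner_fund_weight) (force simp: pos_def)

lemma pos_add: "pos u \<Longrightarrow> pos v \<Longrightarrow> pos (u + v)"
  by (simp add: pos_def inner_add_right)

lemma root_pos_or_neg: "\<beta> \<in> \<Phi> \<Longrightarrow> pos \<beta> \<or> pos (- \<beta>)"
  using simple pos_nonneg_comb by (auto simp: simple_system_def)

text \<open>\<open>pos\<close> sees only real inequalities. The natural coefficients that
  \<open>root_less\<close> demands come back from the dichotomy in \<open>simple_system\<close>: its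
  negative alternative would make the root zero.\<close>

lemma pos_iff_nonneg_comb: "\<beta> \<in> \<Phi> \<Longrightarrow> pos \<beta> \<longleftrightarrow> nonneg_comb r \<alpha> \<beta>"
  using simple pos_nonneg_comb pos_antisym root_nonzero
  by (metis simple_system_def)

lemma pos_simple: "i \<in> {1..r} \<Longrightarrow> pos (\<alpha> i)"
  by (auto simp: pos_def fund_weight_inner_simple)

section \<open>Sign changes of roots, exchange and dominance\<close>

text \<open>\<open>s i\<close> changes only the coefficient of \<alpha>_i. If \<beta> became
  negative, its other coefficients would vanish, and \<alpha>_i is the only positive multiple of
  itself that is a root.\<close>

lemma refl_simple_pos:
  assumes i: "i \<in> {1..r}" and b: "\<beta> \<in> \<Phi>" "pos \<beta>" "\<beta> \<noteq> \<alpha> i"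
  shows "pos (s i \<beta>)"
proof (rule ccontr)
  assume "\<not> pos (s i \<beta>)"
  moreover have "s i \<beta> \<in> \<Phi>" using word_prod_root[of "[i]" \<beta>] i b by simp
  ultimately have n: "pos (- s i \<beta>)" using root_pos_or_neg by blast
  have *: "\<omega> j \<bullet> \<beta> = 0" if j: "j \<in> {1..r}" "j \<noteq> i" for j
  proof -
    have "\<omega> j \<bullet> s i \<beta> = \<omega> j \<bullet> \<beta>"
      using j i by (simp add: refl_along_def inner_diff_right fund_weight_inner_simple)
    then show ?thesis using n b(2) j by (force simp: pos_def)
  qed
  define t where "t = 2 * (\<omega> i \<bullet> \<beta>) / (\<alpha> i \<bullet> \<alpha> i)"
  have "\<beta> = t *\<^sub>R \<alpha> i"
    by (rule eq_if_inner_fund_weight)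
      (use * i simple_nonzero[OF i] in \<open>auto simp: t_def fund_weight_inner_simple\<close>)
  moreover have "t = 1 \<or> t = -1"
    using root simple_in[OF i] b(1) \<open>\<beta> = t *\<^sub>R \<alpha> i\<close> by (auto simp: root_system_def)
  moreover have "t \<ge> 0" using b(2) i by (auto simp: t_def pos_def)
  ultimately show False using b(3) by auto
qed

text \<open>\<open>word_prod\<close> applies the last letter first. At a letter where the sign turns
  negative, \<open>refl_simple_pos\<close> leaves only the simple root of that letter.\<close>

lemma inversion_prefix:
  assumes "set ws \<subseteq> {1..r}" "\<beta> \<in> \<Phi>" "pos \<beta>" "\<not> pos (word_prod \<alpha> ws \<beta>)"
  shows "\<exists>as j bs. ws = as @ j # bs \<and> word_prod \<alpha> bs \<beta> = \<alpha> j"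
  using assms
proof (induction ws)
  case (Cons i ws)
  show ?case
  proof (cases "pos (word_prod \<alpha> ws \<beta>)")
    case True
    then have "word_prod \<alpha> ws \<beta> = \<alpha> i"
      using refl_simple_pos[of i "word_prod \<alpha> ws \<beta>"] Cons.prems word_prod_root[of ws \<beta>]
      by auto
    then show ?thesis by force
  next
    case False
    with Cons obtain as j bs where "ws = as @ j # bs" "word_prod \<alpha> bs \<beta> = \<alpha> j" by auto
    then show ?thesis by (metis append_Cons)
  qed
qed simp

text \<open>\<open>bs\<close> carries \<alpha>_i to \<alpha>_j, so moving \<open>s i\<close>
  leftwards through \<open>bs\<close> turns it into \<open>s j\<close>, which cancels the letter
  \<open>j\<close>.\<close>

lemma exchange:
  assumes "set ws \<subseteq> {1..r}" "i \<in> {1..r}" "\<not> pos (word_prod \<alpha> ws (\<alpha> i))"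
  shows "\<exists>js. set js \<subseteq> {1..r} \<and> Suc (length js) = length ws \<and>
      word_prod \<alpha> js = word_prod \<alpha> ws \<circ> s i"
proof -
  from inversion_prefix[OF assms(1) simple_in[OF assms(2)] pos_simple[OF assms(2)] assms(3)]
  obtain as j bs where ws: "ws = as @ j # bs" "word_prod \<alpha> bs (\<alpha> i) = \<alpha> j"
    by auto
  have "word_prod \<alpha> bs (s i x) = s j (word_prod \<alpha> bs x)" for x
    using refl_along_conjugate[OF linear_word_prod inner_word_prod, of \<alpha> bs "\<alpha> i" x] ws by simp
  then have "word_prod \<alpha> (as @ bs) = word_prod \<alpha> ws \<circ> s i"
    by (auto simp: ws fun_eq_iff)
  then show ?thesis using assms(1) ws(1) by (intro exI[of _ "as @ bs"]) auto
qed

text \<open>In a nonempty word ending in \<open>i\<close>, the part before \<open>i\<close> sends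
  \<alpha>_i to a negative root, so \<open>exchange\<close> represents the same element with two
  letters fewer.\<close>

lemma word_prod_eq_id:
  assumes "set ws \<subseteq> {1..r}" "\<And>i. i \<in> {1..r} \<Longrightarrow> pos (word_prod \<alpha> ws (\<alpha> i))"
  shows "word_prod \<alpha> ws = id"
  using assms
proof (induction "length ws" arbitrary: ws rule: less_induct)
  case less
  show ?case
  proof (cases ws rule: rev_cases)
    case (snoc js i)
    then have i: "i \<in> {1..r}" "set js \<subseteq> {1..r}" using less.prems by auto
    have lin: "word_prod \<alpha> ws (\<alpha> i) = - word_prod \<alpha> js (\<alpha> i)"
      using snoc i refl_along_self[OF simple_nonzero[OF i(1)]]
      by (simp add: word_prod_minus)
    have "\<not> pos (word_prod \<alpha> js (\<alpha> i))"
      using less.prems(2)[OF i(1)] lin pos_antisym[of "word_prod \<alpha> js (\<alpha> i)"]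
        root_nonzero[OF word_prod_root[OF i(2) simple_in[OF i(1)]]] by auto
    from exchange[OF i(2,1) this] obtain ks where ks: "set ks \<subseteq> {1..r}"
      "Suc (length ks) = length js" "word_prod \<alpha> ks = word_prod \<alpha> js \<circ> s i" by blast
    then have eq: "word_prod \<alpha> ks = word_prod \<alpha> ws" using snoc by simp
    have "word_prod \<alpha> ks = id"
      using ks snoc less.prems(2) eq by (intro less.hyps) auto
    then show ?thesis using eq by simp
  qed simp
qed

lemma weyl_groupE:
  assumes "w \<in> W" obtains ws where "set ws \<subseteq> {1..r}" "w = word_prod \<alpha> ws"
  using assms by (auto simp: weyl_group_def lists_eq_set)

lemma word_prod_in_weyl [intro]: "set ws \<subseteq> {1..r} \<Longrightarrow> word_prod \<alpha> ws \<in> W"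
  by (auto simp: weyl_group_def lists_eq_set)

text \<open>Unless the element is the identity, \<open>exchange\<close> strips off some
  \<open>s i\<close>; putting it back subtracts from the image of \<omega>_k either nothing or the
  positive root \<open>word_prod \<alpha> js (\<alpha> i)\<close>.\<close>

lemma dominated_by_fund_weight:
  assumes "set ws \<subseteq> {1..r}" "k \<in> {1..r}"
  shows "pos (\<omega> k - word_prod \<alpha> ws (\<omega> k))"
  using assms(1)
proof (induction "length ws" arbitrary: ws rule: less_induct)
  case less
  show ?case
  proof (cases "\<forall>i\<in>{1..r}. pos (word_prod \<alpha> ws (\<alpha> i))")
    case True
    then have "word_prod \<alpha> ws = id" using word_prod_eq_id less.prems by blast
    then show ?thesis by (simp add: pos_def)
  next
    case False
    then obtain i where i: "i \<in> {1..r}" "\<not> pos (word_prod \<alpha> ws (\<alpha> i))" by blast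
    from exchange[OF less.prems i] obtain js where js: "set js \<subseteq> {1..r}"
      "Suc (length js) = length ws" "word_prod \<alpha> js = word_prod \<alpha> ws \<circ> s i" by blast
    have 1: "pos (\<omega> k - word_prod \<alpha> js (\<omega> k))" using js by (intro less.hyps) auto
    have eq: "word_prod \<alpha> ws (\<alpha> i) = - word_prod \<alpha> js (\<alpha> i)"
      using js(3) refl_along_self[OF simple_nonzero[OF i(1)]]
      by (simp add: word_prod_minus)
    have 2: "pos (word_prod \<alpha> js (\<alpha> i))"
      using i eq root_pos_or_neg[OF word_prod_root[OF js(1) simple_in[OF i(1)]]] by auto
    have "word_prod \<alpha> ws (\<omega> k) = word_prod \<alpha> js (s i (\<omega> k))"
      using js(3) by simp
    then show ?thesis
      using 1 2 i(1) assms(2) pos_add[OF 1 2]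
      by (auto simp: refl_fund_weight word_prod_diff algebra_simps)
  qed
qed

text \<open>Two fundamental weights in one Weyl orbit dominate each other.\<close>

lemma weyl_fund_weight_eq:
  assumes "w \<in> W" "i \<in> {1..r}" "j \<in> {1..r}" "w (\<omega> i) = \<omega> j"
  shows "i = j"
proof -
  obtain ws where ws: "set ws \<subseteq> {1..r}" "w = word_prod \<alpha> ws"
    using assms(1) by (rule weyl_groupE)
  have "pos (\<omega> i - \<omega> j)" using dominated_by_fund_weight[OF ws(1) assms(2)] assms ws by simp
  moreover have "word_prod \<alpha> (rev ws) (\<omega> j) = \<omega> i"
    using assms(4) ws by (metis word_prod_rev_cancel)
  then have "pos (\<omega> j - \<omega> i)"
    using dominated_by_fund_weight[of "rev ws" j] assms ws by simp
  ultimately have "\<omega> i - \<omega> j = 0" by (intro pos_antisym) auto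
  then show ?thesis using fund_weight_inj assms by simp
qed

section \<open>Length and the longest element\<close>

lemma finite_weyl: "finite W"
proof -
  have fin: "finite (\<Phi> \<rightarrow>\<^sub>E \<Phi>)"
    using root by (auto simp: root_system_def intro: finite_PiE)
  have sub: "(\<lambda>w. restrict w \<Phi>) ` W \<subseteq> \<Phi> \<rightarrow>\<^sub>E \<Phi>"
    by (auto elim!: weyl_groupE intro: word_prod_root)
  have inj: "inj_on (\<lambda>w. restrict w \<Phi>) W"
  proof (rule inj_onI)
    fix u w assume uw: "u \<in> W" "w \<in> W" and eq: "restrict u \<Phi> = restrict w \<Phi>"
    have "linear u" "linear w" using uw by (auto elim!: weyl_groupE intro: linear_word_prod)
    moreover have "u x = w x" if "x \<in> \<Phi>" for x using eq that by (metis restrict_apply)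
    ultimately have "u x = w x" for x
      using linear_eq_on_span[of u w \<Phi> x] root by (auto simp: root_system_def)
    then show "u = w" by auto
  qed
  show ?thesis using finite_imageD[OF finite_subset[OF sub fin] inj] .
qed

lemma weyl_length_le: "set ws \<subseteq> {1..r} \<Longrightarrow> weyl_length r \<alpha> (word_prod \<alpha> ws) \<le> length ws"
  unfolding weyl_length_def by (intro Least_le) auto

lemma reduced_word:
  assumes "w \<in> W"
  obtains ws where "set ws \<subseteq> {1..r}" "w = word_prod \<alpha> ws" "length ws = weyl_length r \<alpha> w"
proof -
  have "\<exists>k. \<exists>ws\<in>lists {1..r}. length ws = k \<and> word_prod \<alpha> ws = w"
    using assms by (auto simp: weyl_group_def)
  from LeastI_ex[OF this] show ?thesis
    using that unfolding weyl_length_def by auto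
qed

text \<open>The product sends \<alpha>_i to a negative root, so \<open>exchange\<close> shortens a
  reduced word of it to a word for \<open>w\<close>.\<close>

lemma weyl_length_refl_less:
  assumes "w \<in> W" "i \<in> {1..r}" "pos (w (\<alpha> i))"
  shows "weyl_length r \<alpha> w < weyl_length r \<alpha> (w \<circ> s i)" and "w \<circ> s i \<in> W"
proof -
  obtain ks where ks: "set ks \<subseteq> {1..r}" "w = word_prod \<alpha> ks" using assms(1) by (rule weyl_groupE)
  then have "w \<circ> s i = word_prod \<alpha> (ks @ [i])" by simp
  then show W: "w \<circ> s i \<in> W" using ks assms(2) by (metis word_prod_in_weyl set_append Un_subset_iff
        empty_set empty_subsetI insert_subset list.simps(15))
  obtain ws where ws: "set ws \<subseteq> {1..r}" "w \<circ> s i = word_prod \<alpha> ws"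
    "length ws = weyl_length r \<alpha> (w \<circ> s i)"
    using W by (rule reduced_word)
  have "word_prod \<alpha> ws (\<alpha> i) = - w (\<alpha> i)"
    using ws(2)[symmetric] refl_along_self[OF simple_nonzero[OF assms(2)]]
      linear_neg[OF linear_word_prod] ks(2) by simp
  moreover have "w (\<alpha> i) \<noteq> 0" "w (\<alpha> i) \<in> \<Phi>"
    using ks word_prod_root[OF ks(1) simple_in[OF assms(2)]] root_nonzero by auto
  ultimately have "\<not> pos (word_prod \<alpha> ws (\<alpha> i))"
    using assms(3) pos_antisym[of "w (\<alpha> i)"] by auto
  from exchange[OF ws(1) assms(2) this] obtain js where js: "set js \<subseteq> {1..r}"
    "Suc (length js) = length ws" "word_prod \<alpha> js = word_prod \<alpha> ws \<circ> s i" by blast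
  then have "word_prod \<alpha> js = w" using ws(2)[symmetric] by (auto simp: fun_eq_iff)
  then show "weyl_length r \<alpha> w < weyl_length r \<alpha> (w \<circ> s i)"
    using weyl_length_le[OF js(1)] js(2) ws(3) by simp
qed

text \<open>An element sending every simple root negative, composed with the inverse of
  \<open>z\<close>, keeps every simple root positive and so equals \<open>z\<close>. Any other
  element can be lengthened by some \<open>s i\<close>; the maximal length, which exists by
  finiteness, is thus attained at \<open>z\<close> alone.\<close>

lemma longest_element_eq:
  assumes z: "z \<in> W" and neg: "\<And>j. j \<in> {1..r} \<Longrightarrow> \<exists>i\<in>{1..r}. z (\<alpha> i) = - \<alpha> j"
  shows "longest_element r \<alpha> = z"
proof -
  obtain zs where zs: "set zs \<subseteq> {1..r}" "z = word_prod \<alpha> zs" using z by (rule weyl_groupE)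
  have longer: "\<exists>u'\<in>W. weyl_length r \<alpha> u < weyl_length r \<alpha> u'" if u: "u \<in> W" "u \<noteq> z" for u
  proof -
    obtain us where us: "set us \<subseteq> {1..r}" "u = word_prod \<alpha> us" using u(1) by (rule weyl_groupE)
    have "\<exists>i\<in>{1..r}. pos (u (\<alpha> i))"
    proof (rule ccontr)
      assume "\<not> ?thesis"
      then have neg_u: "pos (- u (\<alpha> i))" if "i \<in> {1..r}" for i
        using that root_pos_or_neg[OF word_prod_root[OF us(1) simple_in[OF that]]] us(2) by auto
      have "pos (word_prod \<alpha> (us @ rev zs) (\<alpha> j))" if j: "j \<in> {1..r}" for j
      proof -
        obtain i where i: "i \<in> {1..r}" "z (\<alpha> i) = - \<alpha> j" using neg[OF j] by blast
        then have "word_prod \<alpha> (rev zs) (- \<alpha> j) = \<alpha> i"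
          using zs(2) word_prod_rev_cancel by metis
        then have "word_prod \<alpha> (rev zs) (\<alpha> j) = - \<alpha> i"
          using linear_neg[OF linear_word_prod, of \<alpha> "rev zs" "\<alpha> j"]
          by (metis minus_minus)
        then show ?thesis
          using neg_u[OF i(1)] us(2) linear_neg[OF linear_word_prod, of \<alpha> us "\<alpha> i"] by simp
      qed
      then have "word_prod \<alpha> (us @ rev zs) = id"
        using us zs by (intro word_prod_eq_id) auto
      then have "u = z" using us(2) zs(2)
        by (metis comp_apply eq_id_iff ext word_prod_append word_prod_rev_cancel)
      with u show False by simp
    qed
    then show ?thesis using weyl_length_refl_less[OF u(1)] by blast
  qed
  define M where "M = Max (weyl_length r \<alpha> ` W)"
  have fin: "finite (weyl_length r \<alpha> ` W)" using finite_weyl by simp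
  have "M \<in> weyl_length r \<alpha> ` W" unfolding M_def using fin z by (intro Max_in) auto
  then obtain x where x: "x \<in> W" "weyl_length r \<alpha> x = M" by auto
  have le: "weyl_length r \<alpha> u \<le> M" if "u \<in> W" for u
    using fin that by (simp add: M_def)
  have "x = z" using longer[of x] le x by fastforce
  then show ?thesis
    unfolding longest_element_def using x le longer
    by (intro the_equality) (auto simp: not_le[symmetric])
qed

end

section \<open>Tree diagrams with a half-periodic wave equation\<close>

definition nb :: "nat \<Rightarrow> (nat \<Rightarrow> nat \<Rightarrow> int) \<Rightarrow> nat \<Rightarrow> nat set" where
  "nb r A i = {j \<in> {1..r}. j \<noteq> i \<and> A i j \<noteq> 0}"

text \<open>Polymorphic in the values: the half period is established for real solutions and
  transferred to vector-valued ones by pairing with an arbitrary vector.\<close>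

definition wave :: "nat \<Rightarrow> (nat \<Rightarrow> nat \<Rightarrow> int) \<Rightarrow> (nat \<Rightarrow> int \<Rightarrow> 'b::ab_group_add) \<Rightarrow> bool" where
  "wave r A Y \<longleftrightarrow>
     (\<forall>i\<in>{1..r}. \<forall>t. Y i t + Y i (t + 2) = (\<Sum>j\<in>nb r A i. Y j (t + 1)))"

lemma finite_nb [simp]: "finite (nb r A i)"
  by (simp add: nb_def)

text \<open>Collects all that depends on the type. The injective ranking \<open>\<rho>\<close>
  encodes the tree: a node not of least rank has exactly one neighbour of lower rank, its parent.
  \<open>v\<close> is an eigenvector of the adjacency matrix for the eigenvalue 2 cos(pi/h).\<close>

locale dynkin_tree =
  fixes r :: nat and A :: "nat \<Rightarrow> nat \<Rightarrow> int" and h :: nat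
    and \<tau> \<rho> :: "nat \<Rightarrow> nat" and v :: "nat \<Rightarrow> real"
  assumes rank_less: "r < h"
    and offdiag: "\<And>i j. i \<in> {1..r} \<Longrightarrow> j \<in> {1..r} \<Longrightarrow> i \<noteq> j \<Longrightarrow> A i j \<in> {0, -1}"
    and sym: "\<And>i j. i \<in> {1..r} \<Longrightarrow> j \<in> {1..r} \<Longrightarrow> A i j = A j i"
    and \<tau>_in: "\<And>i. i \<in> {1..r} \<Longrightarrow> \<tau> i \<in> {1..r}"
    and \<tau>_\<tau>: "\<And>i. i \<in> {1..r} \<Longrightarrow> \<tau> (\<tau> i) = i"
    and A_\<tau>: "\<And>i j. i \<in> {1..r} \<Longrightarrow> j \<in> {1..r} \<Longrightarrow> A (\<tau> i) (\<tau> j) = A i j"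
    and inj_rank: "inj_on \<rho> {1..r}"
    and parent: "\<And>i. i \<in> {1..r} \<Longrightarrow>
        (\<forall>j\<in>{1..r}. \<rho> i \<le> \<rho> j) \<or> (\<exists>p\<in>{1..r}. {j \<in> nb r A i. \<rho> j < \<rho> i} = {p})"
    and eigen_nonzero: "\<And>i. i \<in> {1..r} \<Longrightarrow> v i \<noteq> 0"
    and eigen: "\<And>i. i \<in> {1..r} \<Longrightarrow> (\<Sum>j\<in>nb r A i. v j) = 2 * cos (pi / h) * v i"
    and half_period: "\<And>(Y :: nat \<Rightarrow> int \<Rightarrow> real) i t. wave r A Y \<Longrightarrow> i \<in> {1..r} \<Longrightarrow>
        Y i (t + int h) = - Y (\<tau> i) t"
begin

lemma nb_sym: "i \<in> {1..r} \<Longrightarrow> j \<in> nb r A i \<Longrightarrow> i \<in> nb r A j"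
  using sym by (auto simp: nb_def)

lemma nb_\<tau>: "i \<in> {1..r} \<Longrightarrow> j \<in> nb r A i \<Longrightarrow> \<tau> j \<in> nb r A (\<tau> i)"
  using A_\<tau> \<tau>_in \<tau>_\<tau> by (simp add: nb_def) (metis atLeastAtMost_iff)

section \<open>Paths and heights on a tree\<close>

lemma path_alt: "dynkin_path r A i j p \<longleftrightarrow>
    p \<noteq> [] \<and> hd p = i \<and> last p = j \<and> set p \<subseteq> {1..r} \<and> distinct p \<and>
    successively (\<lambda>x y. A x y \<noteq> 0) p"
  by (auto simp: dynkin_path_def successively_conv_nth)

lemma path_rev:
  assumes "dynkin_path r A i j p"
  shows "dynkin_path r A j i (rev p)"
proof -
  have "successively (\<lambda>x y. A y x \<noteq> 0) p"
    using assms unfolding path_alt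
    by (elim conjE successively_mono) (use sym in \<open>auto simp: subset_iff\<close>)
  then show ?thesis using assms unfolding path_alt by (simp add: hd_rev last_rev successively_rev)
qed

text \<open>At an interior vertex of maximal rank, the predecessor and the successor on the path
  would be two distinct parents.\<close>

lemma path_rank_le:
  assumes p: "dynkin_path r A i j p" and x: "x \<in> set p"
  shows "\<rho> x \<le> max (\<rho> i) (\<rho> j)"
proof -
  have ne: "finite (\<rho> ` set p)" "\<rho> ` set p \<noteq> {}" using x by auto
  then have "Max (\<rho> ` set p) \<in> \<rho> ` set p" by (rule Max_in)
  then obtain y where y: "y \<in> set p" "\<rho> y = Max (\<rho> ` set p)" by auto
  have ymax: "\<rho> z \<le> \<rho> y" if "z \<in> set p" for z using ne that y(2) by simp
  from y(1) obtain k where k: "k < length p" "y = p ! k" by (auto simp: in_set_conv_nth)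
  have "y = i \<or> y = j"
  proof (rule ccontr)
    assume *: "\<not> ?thesis"
    from p have hl: "p ! 0 = i" "p ! (length p - 1) = j" "set p \<subseteq> {1..r}" "distinct p"
      and adj: "\<And>k. Suc k < length p \<Longrightarrow> A (p ! k) (p ! Suc k) \<noteq> 0"
      by (auto simp: dynkin_path_def hd_conv_nth last_conv_nth)
    obtain l where l: "k = Suc l" using * hl k by (cases k) auto
    have k': "Suc k < length p" using * hl k by (metis One_nat_def Suc_lessI diff_Suc_1)
    have "q \<in> {q \<in> nb r A y. \<rho> q < \<rho> y}" if "q = p ! l \<or> q = p ! Suc k" for q
    proof -
      have q: "q \<in> set p" using that k k' l by auto
      then have R: "q \<in> {1..r}" "y \<in> {1..r}" using y(1) hl(3) by blast+
      have "q \<noteq> y" using that k k' l hl(4) by (auto simp: nth_eq_iff_index_eq)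
      moreover from this have "\<rho> q \<noteq> \<rho> y" using q y(1) hl(3) inj_rank by (auto simp: inj_on_def)
      moreover have "A y q \<noteq> 0"
        using that adj[of l] adj[of k] k k' l sym[OF R] by auto
      ultimately show ?thesis using R ymax[OF q] by (auto simp: nb_def)
    qed
    then have in2: "p ! l \<in> {q \<in> nb r A y. \<rho> q < \<rho> y}" "p ! Suc k \<in> {q \<in> nb r A y. \<rho> q < \<rho> y}"
      by blast+
    have "p ! l \<noteq> p ! Suc k" using k k' l hl(4) by (auto simp: nth_eq_iff_index_eq)
    moreover have "y \<in> {1..r}" using y(1) hl(3) by auto
    moreover have "p ! l \<in> {1..r}" "\<rho> (p ! l) < \<rho> y" using in2 by (auto simp: nb_def)
    ultimately obtain q where "{q \<in> nb r A y. \<rho> q < \<rho> y} = {q}"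
      using parent[of y] by (metis linorder_not_less)
    with in2 have "p ! l = q" "p ! Suc k = q" by blast+
    with \<open>p ! l \<noteq> p ! Suc k\<close> show False by simp
  qed
  then show ?thesis using ymax[OF x] by auto
qed

lemma path_Cons:
  assumes "p \<noteq> []"
  shows "dynkin_path r A i j (x # p) \<longleftrightarrow>
    x = i \<and> i \<in> {1..r} \<and> i \<notin> set p \<and> A i (hd p) \<noteq> 0 \<and> dynkin_path r A (hd p) j p"
  using assms by (auto simp: path_alt successively_Cons)

text \<open>When \<rho> j < \<rho> i, \<open>path_rank_le\<close> forces the first edge out of
  \<open>i\<close> to lead to its parent, so paths from \<open>i\<close> correspond to paths from
  the parent. The opposite case follows by reversal.\<close>

lemma ex1_path: "i \<in> {1..r} \<Longrightarrow> j \<in> {1..r} \<Longrightarrow> \<exists>!p. dynkin_path r A i j p"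
proof (induction "\<rho> i + \<rho> j" arbitrary: i j rule: less_induct)
  case less
  have step: "\<exists>!p. dynkin_path r A i j p"
    if ij: "i \<in> {1..r}" "j \<in> {1..r}" and lt: "\<rho> j < \<rho> i"
    and IH: "\<And>k. k \<in> {1..r} \<Longrightarrow> \<rho> k < \<rho> i \<Longrightarrow> \<exists>!p. dynkin_path r A k j p" for i j
  proof -
    obtain q where q: "q \<in> {1..r}" "{k \<in> nb r A i. \<rho> k < \<rho> i} = {q}"
      using parent[OF ij(1)] ij(2) lt by force
    then have "q \<in> {k \<in> nb r A i. \<rho> k < \<rho> i}" by blast
    then have q': "A i q \<noteq> 0" "\<rho> q < \<rho> i" by (auto simp: nb_def)
    from IH[OF q(1) q'(2)] obtain p where p: "dynkin_path r A q j p"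
      and p_uniq: "\<And>p'. dynkin_path r A q j p' \<Longrightarrow> p' = p" by auto
    have pne: "p \<noteq> []" "hd p = q" using p by (auto simp: path_alt)
    show ?thesis
    proof (rule ex1I[of _ "i # p"])
      have "i \<notin> set p" using path_rank_le[OF p, of i] lt q'(2) by auto
      then show "dynkin_path r A i j (i # p)"
        using p pne q' ij by (subst path_Cons) auto
    next
      fix p' assume p': "dynkin_path r A i j p'"
      then obtain p'' where p'': "p' = i # p''" by (cases p') (auto simp: path_alt)
      have ne: "p'' \<noteq> []" using p' p'' lt by (auto simp: path_alt)
      then have hd: "hd p'' \<in> set p'" using p'' by simp
      have *: "i \<notin> set p''" "A i (hd p'') \<noteq> 0" "dynkin_path r A (hd p'') j p''"
        using p' p'' path_Cons[OF ne] by auto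
      have hR: "hd p'' \<in> {1..r}" using p' hd by (auto simp: path_alt)
      have "hd p'' \<noteq> i" using *(1) ne hd_in_set by blast
      then have "\<rho> (hd p'') \<noteq> \<rho> i" using inj_onD[OF inj_rank _ hR ij(1)] by blast
      then have "\<rho> (hd p'') < \<rho> i" using path_rank_le[OF p' hd] lt by linarith
      then have "hd p'' \<in> {k \<in> nb r A i. \<rho> k < \<rho> i}"
        using * hR \<open>hd p'' \<noteq> i\<close> by (auto simp: nb_def)
      then have "hd p'' = q" using q(2) by blast
      then show "p' = i # p" using p_uniq *(3) p'' by simp
    qed
  qed
  consider "i = j" | "\<rho> j < \<rho> i" | "\<rho> i < \<rho> j"
    using inj_rank less.prems by (meson inj_on_def linorder_neqE_nat)
  then show ?case
  proof cases
    case 1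
    show ?thesis
    proof (rule ex1I[of _ "[i]"])
      show "dynkin_path r A i j [i]" using 1 less.prems by (simp add: path_alt)
    next
      fix p assume p: "dynkin_path r A i j p"
      then show "p = [i]"
        using 1 by (cases p) (auto simp: path_alt split: if_splits)
    qed
  next
    case 2
    show ?thesis by (rule step[OF less.prems 2]) (use less in auto)
  next
    case 3
    have "\<exists>!p. dynkin_path r A j i p"
    proof (rule step[OF less.prems(2,1) 3])
      fix k assume "k \<in> {1..r}" "\<rho> k < \<rho> j"
      then show "\<exists>!p. dynkin_path r A k i p" using less by auto
    qed
    then show ?thesis using path_rev rev_rev_ident by metis
  qed
qed

text \<open>Nodes are added in order of rank. A new node has at most one edge to the earlier ones,
  so its height can be read off that edge and no compatibility condition arises.\<close>

lemma ex_heights: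
  "\<exists>\<xi> :: nat \<Rightarrow> int. \<forall>i\<in>{1..r}. \<forall>j\<in>nb r A i. i < j \<longrightarrow> \<xi> j = \<xi> i + 1"
proof -
  have "\<exists>\<xi> :: nat \<Rightarrow> int. \<forall>i\<in>{1..r}. \<forall>j\<in>nb r A i. \<rho> i < m \<longrightarrow> \<rho> j < m \<longrightarrow> i < j \<longrightarrow> \<xi> j = \<xi> i + 1"
    for m
  proof (induction m)
    case (Suc m)
    then obtain \<xi> :: "nat \<Rightarrow> int" where
      \<xi>: "\<And>i j. i \<in> {1..r} \<Longrightarrow> j \<in> nb r A i \<Longrightarrow> \<rho> i < m \<Longrightarrow> \<rho> j < m \<Longrightarrow> i < j \<Longrightarrow> \<xi> j = \<xi> i + 1"
      by blast
    show ?case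
    proof (cases "\<exists>x\<in>{1..r}. \<rho> x = m")
      case False
      then show ?thesis
        using \<xi> by (intro exI[of _ \<xi>]) (auto simp: nb_def less_Suc_eq)
    next
      case True
      then obtain x where x: "x \<in> {1..r}" "\<rho> x = m" by blast
      define B where "B = {j \<in> nb r A x. \<rho> j < \<rho> x}"
      have x_eq: "i = x" if "i \<in> {1..r}" "\<rho> i = m" for i
        using inj_onD[OF inj_rank _ that(1) x(1)] that(2) x(2) by simp
      have "B = {} \<or> (\<exists>p. B = {p})"
        using parent[OF x(1)]
      proof
        assume "\<forall>j\<in>{1..r}. \<rho> x \<le> \<rho> j"
        then have "B = {}" unfolding B_def nb_def by (auto simp: not_less)
        then show ?thesis ..
      qed (auto simp: B_def)
      then obtain p where p: "B \<subseteq> {p}" by blast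
      define \<xi>' where "\<xi>' = \<xi>(x := if p < x then \<xi> p + 1 else \<xi> p - 1)"
      have "\<xi>' j = \<xi>' i + 1"
        if i: "i \<in> {1..r}" and j: "j \<in> nb r A i" and lt: "\<rho> i < Suc m" "\<rho> j < Suc m" "i < j" for i j
      proof -
        have jR: "j \<in> {1..r}" using j by (simp add: nb_def)
        consider "i = x" "j \<noteq> x" | "j = x" "i \<noteq> x" | "i \<noteq> x" "j \<noteq> x" using lt(3) by auto
        then show ?thesis
        proof cases
          case 1
          then have "\<rho> j \<noteq> m" using x_eq[OF jR] by blast
          then have "\<rho> j < \<rho> x" using x(2) lt(2) by linarith
          then have "j = p" using 1 j p by (auto simp: B_def)
          then show ?thesis using 1 lt by (auto simp: \<xi>'_def)
        next
          case 2
          then have "\<rho> i \<noteq> m" using x_eq[OF i] by blast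
          then have "\<rho> i < \<rho> x" using x(2) lt(1) by linarith
          then have "i = p" using 2 p nb_sym[OF i j] by (auto simp: B_def)
          then show ?thesis using 2 lt by (auto simp: \<xi>'_def)
        next
          case 3
          then have "\<rho> i \<noteq> m" "\<rho> j \<noteq> m" using x_eq[OF i] x_eq[OF jR] by blast+
          then have "\<rho> i < m" "\<rho> j < m" using lt by linarith+
          then show ?thesis using \<xi>[OF i j] 3 lt by (simp add: \<xi>'_def)
        qed
      qed
      then show ?thesis by blast
    qed
  qed auto
  from this[of "Suc (Max (\<rho> ` {1..r}))"] obtain \<xi> :: "nat \<Rightarrow> int" where
    \<xi>: "\<forall>i\<in>{1..r}. \<forall>j\<in>nb r A i. \<rho> i < Suc (Max (\<rho> ` {1..r})) \<longrightarrow>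
      \<rho> j < Suc (Max (\<rho> ` {1..r})) \<longrightarrow> i < j \<longrightarrow> \<xi> j = \<xi> i + 1" by blast
  have "\<rho> i < Suc (Max (\<rho> ` {1..r}))" if "i \<in> {1..r}" for i
    using that by (simp add: less_Suc_eq_le)
  then show ?thesis
    using \<xi> by (intro exI[of _ \<xi>]) (auto simp: nb_def)
qed

end

text \<open>The bound holds because a path without repetitions has at most r - 1 edges, each
  changing the height by one.\<close>

lemma heights_along_path:
  fixes \<xi> :: "nat \<Rightarrow> int"
  assumes \<xi>: "\<And>i j. i \<in> {1..r} \<Longrightarrow> j \<in> nb r A i \<Longrightarrow> i < j \<Longrightarrow> \<xi> j = \<xi> i + 1"
    and sym: "\<And>i j. i \<in> {1..r} \<Longrightarrow> j \<in> {1..r} \<Longrightarrow> A i j = A j i"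
    and p: "dynkin_path r A i j p"
  shows "\<xi> j - \<xi> i = int (card {k. Suc k < length p \<and> cox_prec A (p ! k) (p ! Suc k)})
      - int (card {k. Suc k < length p \<and> cox_prec A (p ! Suc k) (p ! k)})"
    and "\<bar>\<xi> j - \<xi> i\<bar> < int r"
proof -
  define n where "n = length p - 1"
  have len: "length p = Suc n" using p by (simp add: n_def dynkin_path_def)
  define a where "a = (\<lambda>k. cox_prec A (p ! k) (p ! Suc k))"
  define b where "b = (\<lambda>k. cox_prec A (p ! Suc k) (p ! k))"
  have *: "int (card {k. Suc k < length p \<and> Q k}) = (\<Sum>k<n. if Q k then 1 else 0)" for Q
  proof -
    have "{k. Suc k < length p \<and> Q k} = {k \<in> {..<n}. Q k}" using len by auto
    then show ?thesis by (simp add: sum.If_cases Int_def)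
  qed
  have ab: "\<xi> (p ! Suc k) - \<xi> (p ! k) = (if a k then 1 else 0) - (if b k then 1 else 0)"
    if k: "k < n" for k
  proof -
    have R: "p ! k \<in> {1..r}" "p ! Suc k \<in> {1..r}" and A: "A (p ! k) (p ! Suc k) \<noteq> 0"
      and ne: "p ! k \<noteq> p ! Suc k"
      using p k len by (auto simp: dynkin_path_def subset_iff nth_eq_iff_index_eq)
    have "p ! k \<in> nb r A (p ! Suc k)" "p ! Suc k \<in> nb r A (p ! k)"
      using R A ne sym[OF R] by (auto simp: nb_def)
    then show ?thesis
      using \<xi>[OF R(1), of "p ! Suc k"] \<xi>[OF R(2), of "p ! k"] ne A sym[OF R]
      by (cases "p ! k < p ! Suc k") (auto simp: a_def b_def cox_prec_def)
  qed
  have "p ! 0 = i" "p ! n = j" using p len by (auto simp: dynkin_path_def hd_conv_nth last_conv_nth)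
  then have "\<xi> j - \<xi> i = (\<Sum>k<n. \<xi> (p ! Suc k) - \<xi> (p ! k))"
    by (simp add: sum_lessThan_telescope[of "\<lambda>k. \<xi> (p ! k)"])
  also have "\<dots> = (\<Sum>k<n. (if a k then 1 else 0) - (if b k then 1 else 0))"
    by (intro sum.cong) (auto simp: ab)
  finally have eq: "\<xi> j - \<xi> i = (\<Sum>k<n. (if a k then 1 else 0) - (if b k then 1 else 0))" .
  then show "\<xi> j - \<xi> i = int (card {k. Suc k < length p \<and> cox_prec A (p ! k) (p ! Suc k)})
      - int (card {k. Suc k < length p \<and> cox_prec A (p ! Suc k) (p ! k)})"
    by (simp only: * sum_subtractf a_def b_def)
  have "\<bar>\<xi> j - \<xi> i\<bar> \<le> (\<Sum>k<n. \<bar>(if a k then 1 else 0) - (if b k then 1 else 0)\<bar>)"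
    unfolding eq by (rule sum_abs)
  also have "\<dots> \<le> (\<Sum>k<n. 1)" by (rule sum_mono) auto
  also have "\<dots> = int n" by simp
  finally have "\<bar>\<xi> j - \<xi> i\<bar> \<le> int n" .
  moreover have "length p \<le> r"
    using p distinct_card[of p] card_mono[of "{1..r}" "set p"] by (auto simp: dynkin_path_def)
  ultimately show "\<bar>\<xi> j - \<xi> i\<bar> < int r" using len by linarith
qed

text \<open>\<open>dynkin_tree\<close> does not refer to the order of the labels, on which the
  Coxeter element depends; one standard labelling per type therefore suffices.\<close>

lemma dynkin_tree_relabel:
  assumes \<sigma>: "bij_betw \<sigma> {1..r} {1..r}"
    and AB: "\<And>i j. i \<in> {1..r} \<Longrightarrow> j \<in> {1..r} \<Longrightarrow> A i j = B (\<sigma> i) (\<sigma> j)"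
    and B: "dynkin_tree r B h \<tau> \<rho> v"
  shows "dynkin_tree r A h (inv_into {1..r} \<sigma> \<circ> \<tau> \<circ> \<sigma>) (\<rho> \<circ> \<sigma>) (v \<circ> \<sigma>)"
proof -
  interpret B: dynkin_tree r B h \<tau> \<rho> v by fact
  define \<sigma>' where "\<sigma>' = inv_into {1..r} \<sigma>"
  have \<sigma>R: "\<sigma> i \<in> {1..r}" if "i \<in> {1..r}" for i using \<sigma> that by (auto simp: bij_betw_def)
  have \<sigma>'R: "\<sigma>' i \<in> {1..r}" if "i \<in> {1..r}" for i
    using \<sigma> that unfolding \<sigma>'_def by (metis bij_betw_def inv_into_into)
  have \<sigma>\<sigma>': "\<sigma> (\<sigma>' i) = i" if "i \<in> {1..r}" for i
    using \<sigma> that unfolding \<sigma>'_def by (metis bij_betw_def f_inv_into_f)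
  have \<sigma>'\<sigma>: "\<sigma>' (\<sigma> i) = i" if "i \<in> {1..r}" for i
    using \<sigma> that unfolding \<sigma>'_def by (metis bij_betw_def inv_into_f_f)
  have inj: "\<sigma> i = \<sigma> j \<longleftrightarrow> i = j" if "i \<in> {1..r}" "j \<in> {1..r}" for i j
    using \<sigma>'\<sigma> that by metis
  have bij: "bij_betw \<sigma> (nb r A i) (nb r B (\<sigma> i))" if i: "i \<in> {1..r}" for i
  proof (rule bij_betw_byWitness[where f' = \<sigma>'])
    show "\<forall>j\<in>nb r A i. \<sigma>' (\<sigma> j) = j" using \<sigma>'\<sigma> unfolding nb_def by blast
    show "\<forall>j\<in>nb r B (\<sigma> i). \<sigma> (\<sigma>' j) = j" using \<sigma>\<sigma>' unfolding nb_def by blast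
    show "\<sigma> ` nb r A i \<subseteq> nb r B (\<sigma> i)"
    proof (intro image_subsetI)
      fix j assume "j \<in> nb r A i"
      then have "j \<in> {1..r}" "j \<noteq> i" "A i j \<noteq> 0" by (auto simp: nb_def)
      then show "\<sigma> j \<in> nb r B (\<sigma> i)" using \<sigma>R inj i AB unfolding nb_def by simp
    qed
    show "\<sigma>' ` nb r B (\<sigma> i) \<subseteq> nb r A i"
    proof (intro image_subsetI)
      fix j assume "j \<in> nb r B (\<sigma> i)"
      then have j: "j \<in> {1..r}" "j \<noteq> \<sigma> i" "B (\<sigma> i) j \<noteq> 0" by (auto simp: nb_def)
      moreover have "A i (\<sigma>' j) = B (\<sigma> i) j" using AB[OF i \<sigma>'R] \<sigma>\<sigma>' j(1) by simp
      moreover have "\<sigma>' j \<noteq> i" using \<sigma>\<sigma>'[OF j(1)] j(2) by metis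
      ultimately show "\<sigma>' j \<in> nb r A i" using \<sigma>'R[OF j(1)] unfolding nb_def by simp
    qed
  qed
  show ?thesis
    unfolding \<sigma>'_def[symmetric]
  proof
    show "r < h" by (rule B.rank_less)
  next
    fix i j assume ij: "i \<in> {1..r}" "j \<in> {1..r}"
    show "A i j = A j i" using ij AB B.sym[OF \<sigma>R \<sigma>R] by simp
    show "A ((\<sigma>' \<circ> \<tau> \<circ> \<sigma>) i) ((\<sigma>' \<circ> \<tau> \<circ> \<sigma>) j) = A i j"
      using ij AB B.A_\<tau>[OF \<sigma>R \<sigma>R] \<sigma>\<sigma>'[OF B.\<tau>_in[OF \<sigma>R]] \<sigma>'R[OF B.\<tau>_in[OF \<sigma>R]]
      by (simp del: atLeastAtMost_iff)
    assume "i \<noteq> j"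
    then show "A i j \<in> {0, -1}" using ij AB B.offdiag[OF \<sigma>R \<sigma>R] inj by metis
  next
    fix i assume i: "i \<in> {1..r}"
    show "(\<sigma>' \<circ> \<tau> \<circ> \<sigma>) i \<in> {1..r}"
      using \<sigma>'R[OF B.\<tau>_in[OF \<sigma>R[OF i]]] by simp
    show "(\<sigma>' \<circ> \<tau> \<circ> \<sigma>) ((\<sigma>' \<circ> \<tau> \<circ> \<sigma>) i) = i"
      using i \<sigma>R B.\<tau>_in \<sigma>\<sigma>' \<sigma>'\<sigma> B.\<tau>_\<tau> by (metis comp_apply)
    show "(v \<circ> \<sigma>) i \<noteq> 0" using B.eigen_nonzero[OF \<sigma>R[OF i]] by simp
    show "(\<Sum>j\<in>nb r A i. (v \<circ> \<sigma>) j) = 2 * cos (pi / real h) * (v \<circ> \<sigma>) i"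
      using B.eigen[OF \<sigma>R[OF i]] sum.reindex_bij_betw[OF bij[OF i], of v] by simp
    show "(\<forall>j\<in>{1..r}. (\<rho> \<circ> \<sigma>) i \<le> (\<rho> \<circ> \<sigma>) j) \<or>
        (\<exists>p\<in>{1..r}. {j \<in> nb r A i. (\<rho> \<circ> \<sigma>) j < (\<rho> \<circ> \<sigma>) i} = {p})"
      using B.parent[OF \<sigma>R[OF i]]
    proof (elim disjE bexE)
      fix p assume p: "p \<in> {1..r}" and eq: "{j \<in> nb r B (\<sigma> i). \<rho> j < \<rho> (\<sigma> i)} = {p}"
      have "{j \<in> nb r A i. (\<rho> \<circ> \<sigma>) j < (\<rho> \<circ> \<sigma>) i} = {\<sigma>' p}" (is "?L = _")
      proof (intro equalityI subsetI)
        fix j assume j: "j \<in> ?L"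
        then have "\<sigma> j \<in> {j \<in> nb r B (\<sigma> i). \<rho> j < \<rho> (\<sigma> i)}"
          using bij_betwE[OF bij[OF i]] by auto
        then have "\<sigma> j = p" unfolding eq by simp
        then show "j \<in> {\<sigma>' p}" using \<sigma>'\<sigma>[of j] j by (auto simp: nb_def)
      next
        fix j assume "j \<in> {\<sigma>' p}"
        then have j: "\<sigma> j = p" "j \<in> {1..r}" using \<sigma>\<sigma>'[OF p] \<sigma>'R[OF p] by auto
        have "p \<in> {j \<in> nb r B (\<sigma> i). \<rho> j < \<rho> (\<sigma> i)}" unfolding eq by simp
        then show "j \<in> ?L" using j i AB[OF i j(2)] by (auto simp: nb_def)
      qed
      then show ?thesis using \<sigma>'R[OF p] by blast
    qed (use \<sigma>R in auto)
  next
    show "inj_on (\<rho> \<circ> \<sigma>) {1..r}"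
      using \<sigma> B.inj_rank by (intro comp_inj_on) (auto simp: bij_betw_def)
  next
    fix Y :: "nat \<Rightarrow> int \<Rightarrow> real" and i t
    assume Y: "wave r A Y" and i: "i \<in> {1..r}"
    have "wave r B (\<lambda>k. Y (\<sigma>' k))"
      unfolding wave_def
    proof (intro ballI allI)
      fix k t assume k: "k \<in> {1..r}"
      show "Y (\<sigma>' k) t + Y (\<sigma>' k) (t + 2) = (\<Sum>j\<in>nb r B k. Y (\<sigma>' j) (t + 1))"
        using Y \<sigma>'R[OF k] sum.reindex_bij_betw[OF bij[OF \<sigma>'R[OF k]], of "\<lambda>j. Y (\<sigma>' j) (t + 1)"]
          \<sigma>'\<sigma> by (simp add: wave_def \<sigma>\<sigma>'[OF k] nb_def)
    qed
    from B.half_period[OF this \<sigma>R[OF i]]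
    show "Y i (t + int h) = - Y ((\<sigma>' \<circ> \<tau> \<circ> \<sigma>) i) t"
      using \<sigma>'\<sigma>[OF i] by simp
  qed
qed

section \<open>The types A, D and E6\<close>

lemma dirichlet_wave:
  fixes Z :: "nat \<Rightarrow> int \<Rightarrow> real"
  assumes Z0: "\<And>t. Z 0 t = 0" and Zn: "\<And>t. Z (Suc n) t = 0"
    and Z: "\<And>i t. i \<in> {1..n} \<Longrightarrow> Z i t + Z i (t + 2) = Z (i - 1) (t + 1) + Z (i + 1) (t + 1)"
    and i: "i \<le> Suc n"
  shows "Z i (t + int (Suc n)) = - Z (Suc n - i) t"
proof -
  \<comment> \<open>By the wave equation \<open>Z (i + 1) t - Z i (t + 1)\<close> is constant along
    the characteristic (i, t), (i - 1, t - 1), ..., and at node 0 it is a value of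
    \<open>Z 1\<close>.\<close>
  have first: "Z (Suc i) t = Z i (t + 1) + Z 1 (t - int i)" if "i \<le> n" for i t
    using that
  proof (induction i arbitrary: t)
    case (Suc i)
    have "Z (Suc i) (t - 1) + Z (Suc i) (t + 1) = Z i t + Z (Suc (Suc i)) t"
      using Z[of "Suc i" "t - 1"] Suc.prems by (simp add: add.commute One_nat_def)
    moreover have "Z (Suc i) (t - 1) = Z i t + Z 1 (t - int (Suc i))"
      using Suc.IH[of "t - 1"] Suc.prems by (simp add: algebra_simps)
    ultimately show ?case by simp
  qed (simp add: Z0 One_nat_def)
  \<comment> \<open>An addition formula, obtained from \<open>first\<close> by adding j steps. For i
    + j = n + 1 its left side vanishes at the second end, which leaves the claim.\<close>
  have add: "Z (i + j) t = Z i (t + int j) + Z j (t - int i)" if "i + j \<le> Suc n" for i j t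
    using that
  proof (induction j arbitrary: t)
    case (Suc j)
    have "Z (i + Suc j) t = Z (i + j) (t + 1) + Z 1 (t - int (i + j))"
      using first[of "i + j" t] Suc.prems by simp
    also have "Z (i + j) (t + 1) = Z i (t + int (Suc j)) + Z j (t + 1 - int i)"
      using Suc.IH[of "t + 1"] Suc.prems by (simp add: algebra_simps)
    finally show ?case using first[of j "t - int i"] Suc.prems by (simp add: algebra_simps)
  qed (simp add: Z0)
  have "Z (Suc n) (t + int i) = Z i (t + int i + int (Suc n - i)) + Z (Suc n - i) (t + int i - int i)"
    using add[of i "Suc n - i" "t + int i"] i by simp
  moreover have "t + int i + int (Suc n - i) = t + int (Suc n)" using i by simp
  ultimately show ?thesis using Zn[of "t + int i"] by simp
qed

lemma sin_neighbours:
  fixes \<theta> :: real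
  shows "sin ((x - 1) * \<theta>) + sin ((x + 1) * \<theta>) = 2 * cos \<theta> * sin (x * \<theta>)"
  by (simp add: algebra_simps sin_add sin_diff)

lemma simply_laced_matrix_sym: "simply_laced_matrix E i j = simply_laced_matrix E j i"
  by (auto simp: simply_laced_matrix_def)

lemma simply_laced_matrix_offdiag: "i \<noteq> j \<Longrightarrow> simply_laced_matrix E i j \<in> {0, - 1}"
  by (simp add: simply_laced_matrix_def)

lemma cartan_A_edge:
  "cartan_A n i j = (if i = j then 2
     else if 1 \<le> i \<and> i < n \<and> j = Suc i \<or> 1 \<le> j \<and> j < n \<and> i = Suc j then - 1 else 0)"
  by (auto simp: cartan_A_def simply_laced_matrix_def)

lemma nb_A:
  assumes "i \<in> {1..n}"
  shows "nb n (cartan_A n) i = {i - 1, i + 1} \<inter> {1..n}"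
  using assms by (auto simp: nb_def cartan_A_edge)

text \<open>The virtual nodes 0 and n + 1, with value 0, spare a case distinction at the ends of the
  path.\<close>

lemma sum_nb_A:
  fixes f :: "nat \<Rightarrow> real"
  assumes "i \<in> {1..n}" "f 0 = 0" "f (Suc n) = 0"
  shows "(\<Sum>j\<in>nb n (cartan_A n) i. f j) = f (i - 1) + f (i + 1)"
proof -
  have "(\<Sum>j\<in>nb n (cartan_A n) i. f j) = (\<Sum>j\<in>{i - 1, i + 1}. f j)"
    unfolding nb_A[OF assms(1)]
  proof (rule sum.mono_neutral_left)
    show "\<forall>j\<in>{i - 1, i + 1} - {i - 1, i + 1} \<inter> {1..n}. f j = 0"
    proof
      fix j assume "j \<in> {i - 1, i + 1} - {i - 1, i + 1} \<inter> {1..n}"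
      then have "j = 0 \<or> j = Suc n" using assms(1) by auto
      then show "f j = 0" using assms by auto
    qed
  qed auto
  then show ?thesis by simp
qed

text \<open>The eigenvector is the fundamental mode of a string fixed at the virtual nodes 0 and n +
  1, whence h = n + 1.\<close>

lemma dynkin_tree_A: "dynkin_tree n (cartan_A n) (n + 1) (\<lambda>i. n + 1 - i) id (\<lambda>i. sin (i * (pi / (n + 1))))"
proof
  fix i assume i: "i \<in> {1..n}"
  show "(\<forall>j\<in>{1..n}. id i \<le> id j) \<or> (\<exists>p\<in>{1..n}. {j \<in> nb n (cartan_A n) i. id j < id i} = {p})"
  proof (cases "i = 1")
    case False
    then have "{j \<in> nb n (cartan_A n) i. id j < id i} = {i - 1}"
      using i unfolding nb_A[OF i] by auto
    moreover have "i - 1 \<in> {1..n}" using i False by auto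
    ultimately show ?thesis by blast
  qed auto
  have "real i / (n + 1) < 1" using i by simp
  from mult_strict_left_mono[OF this pi_gt_zero] have "i * (pi / (n + 1)) < pi"
    by (simp add: mult.commute)
  moreover have "0 < i * (pi / (n + 1))" using i by simp
  ultimately show "sin (i * (pi / (n + 1))) \<noteq> 0" using sin_gt_zero by fastforce
  show "(\<Sum>j\<in>nb n (cartan_A n) i. sin (j * (pi / (n + 1)))) =
      2 * cos (pi / real (n + 1)) * sin (i * (pi / (n + 1)))"
  proof (subst sum_nb_A[OF i])
    have "real (Suc n) * (pi / (n + 1)) = pi" by (simp add: field_simps)
    then show "sin (Suc n * (pi / (n + 1))) = 0" by simp
    show "sin ((i - 1) * (pi / (n + 1))) + sin ((i + 1) * (pi / (n + 1))) =
        2 * cos (pi / real (n + 1)) * sin (i * (pi / (n + 1)))"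
      using sin_neighbours[of "real i" "pi / (n + 1)"] i by (simp add: of_nat_diff add_ac)
  qed simp
next
  fix Y :: "nat \<Rightarrow> int \<Rightarrow> real" and i t
  assume Y: "wave n (cartan_A n) Y" and i: "i \<in> {1..n}"
  define Z where "Z k = (if k \<in> {1..n} then Y k else (\<lambda>_. 0))" for k
  have "Z i (t + int (Suc n)) = - Z (Suc n - i) t"
  proof (rule dirichlet_wave)
    fix i t assume i: "i \<in> {1..n}"
    have "(\<Sum>j\<in>nb n (cartan_A n) i. Y j (t + 1)) = (\<Sum>j\<in>nb n (cartan_A n) i. Z j (t + 1))"
      by (intro sum.cong) (auto simp: Z_def nb_def)
    also have "\<dots> = Z (i - 1) (t + 1) + Z (i + 1) (t + 1)"
      by (rule sum_nb_A[OF i]) (auto simp: Z_def)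
    finally show "Z i t + Z i (t + 2) = Z (i - 1) (t + 1) + Z (i + 1) (t + 1)"
      using Y i by (simp add: wave_def Z_def)
  qed (use i in \<open>auto simp: Z_def\<close>)
  moreover have "Suc n - i \<in> {1..n}" using i by auto
  ultimately show "Y i (t + int (n + 1)) = - Y (n + 1 - i) t"
    using i unfolding Suc_eq_plus1 by (simp add: Z_def)
next
  fix i j assume ij: "i \<in> {1..n}" "j \<in> {1..n}"
  then have "n + 1 - i = n + 1 - j \<longleftrightarrow> i = j"
    "n + 1 - j = Suc (n + 1 - i) \<longleftrightarrow> i = Suc j" "n + 1 - i = Suc (n + 1 - j) \<longleftrightarrow> j = Suc i"
    "n + 1 - i < n \<longleftrightarrow> 1 < i" "n + 1 - j < n \<longleftrightarrow> 1 < j" "1 \<le> n + 1 - i" "1 \<le> n + 1 - j"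
    by auto
  then have "cartan_A n (n + 1 - i) (n + 1 - j) =
      (if i = j then 2 else if 1 < i \<and> i = Suc j \<or> 1 < j \<and> j = Suc i then - 1 else 0)"
    unfolding cartan_A_edge by (simp only: simp_thms)
  also have "\<dots> = cartan_A n i j" using ij unfolding cartan_A_edge by auto
  finally show "cartan_A n (n + 1 - i) (n + 1 - j) = cartan_A n i j" .
next
  fix i j
  show "cartan_A n i j = cartan_A n j i" unfolding cartan_A_def by (rule simply_laced_matrix_sym)
  assume "i \<noteq> j"
  then show "cartan_A n i j \<in> {0, - 1}" unfolding cartan_A_def by (rule simply_laced_matrix_offdiag)
next
  fix i assume "i \<in> {1..n}"
  then show "n + 1 - i \<in> {1..n}" "n + 1 - (n + 1 - i) = i" by auto
qed simp_all

text \<open>Writing the rank as N + 2 avoids truncated subtraction: N is the branch node, N + 1 and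
  N + 2 are the ends of the fork.\<close>

definition edge_D :: "nat \<Rightarrow> nat \<Rightarrow> nat \<Rightarrow> bool" where
  "edge_D N i j \<longleftrightarrow> 1 \<le> i \<and> i \<le> N \<and> j = i + 1 \<or> i = N \<and> j = N + 2"

lemma cartan_D_edge:
  "cartan_D (N + 2) i j = (if i = j then 2 else if edge_D N i j \<or> edge_D N j i then - 1 else 0)"
proof -
  have "(i, j) \<in> {(i, Suc i) |i. 1 \<le> i \<and> Suc i < N + 2} \<union> {(N + 2 - 2, N + 2)} \<longleftrightarrow> edge_D N i j" for i j
    unfolding edge_D_def by auto
  then show ?thesis unfolding cartan_D_def simply_laced_matrix_def by presburger
qed

lemma nb_D:
  assumes "1 \<le> N" "i \<in> {1..N + 2}"
  shows "nb (N + 2) (cartan_D (N + 2)) i =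
    (if i < N then {i - 1, i + 1} \<inter> {1..} else if i = N then {N - 1, N + 1, N + 2} \<inter> {1..} else {N})"
  (is "_ = ?B")
proof (rule set_eqI)
  fix j
  have "j \<in> nb (N + 2) (cartan_D (N + 2)) i \<longleftrightarrow>
      1 \<le> j \<and> j \<le> N + 2 \<and> j \<noteq> i \<and> (edge_D N i j \<or> edge_D N j i)"
    unfolding nb_def cartan_D_edge by auto
  also have "\<dots> \<longleftrightarrow> (if i < N then 1 \<le> j \<and> (j + 1 = i \<or> j = i + 1)
      else if i = N then 1 \<le> j \<and> (j + 1 = N \<or> j = N + 1 \<or> j = N + 2) else j = N)"
  proof -
    consider "i < N" | "i = N" | "N < i" by linarith
    then show ?thesis
      by cases (use assms in \<open>auto simp: edge_D_def\<close>)
  qed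
  also have "\<dots> \<longleftrightarrow> j \<in> ?B"
  proof -
    have "j \<in> {i - 1, i + 1} \<inter> {1..} \<longleftrightarrow> 1 \<le> j \<and> (j + 1 = i \<or> j = i + 1)"
      "j \<in> {N - 1, N + 1, N + 2} \<inter> {1..} \<longleftrightarrow> 1 \<le> j \<and> (j + 1 = N \<or> j = N + 1 \<or> j = N + 2)"
      by auto
    then show ?thesis
      by (cases "i < N"; cases "i = N") (simp_all only: if_True if_False singleton_iff simp_thms)
  qed
  finally show "j \<in> nb (N + 2) (cartan_D (N + 2)) i \<longleftrightarrow> j \<in> ?B" .
qed

lemma sum_nb_D:
  fixes f :: "nat \<Rightarrow> real"
  assumes "1 \<le> N" "i \<in> {1..N + 2}" "f 0 = 0"
  shows "(\<Sum>j\<in>nb (N + 2) (cartan_D (N + 2)) i. f j) =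
    (if i < N then f (i - 1) + f (i + 1)
     else if i = N then f (N - 1) + f (N + 1) + f (N + 2) else f N)"
proof -
  have *: "sum f (B \<inter> {1..}) = sum f B" if "finite B" for B
  proof (rule sum.mono_neutral_left)
    show "\<forall>j\<in>B - B \<inter> {1..}. f j = 0"
    proof
      fix j assume "j \<in> B - B \<inter> {1..}"
      then have "j = 0" by auto
      then show "f j = 0" using assms by simp
    qed
  qed (use that in auto)
  show ?thesis
  proof -
    have "(\<Sum>j\<in>{N - 1, N + 1, N + 2}. f j) = f (N - 1) + f (N + 1) + f (N + 2)"
      using assms(1) by (subst sum.insert) auto
    moreover have "(\<Sum>j\<in>{i - 1, i + 1}. f j) = f (i - 1) + f (i + 1)" by simp
    ultimately show ?thesis
      unfolding nb_D[OF assms(1,2)] by (simp only: * finite.intros sum.insert sum.empty split: if_split) simp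
  qed
qed

text \<open>The eigenvector is the sine vector of the path with 2 N + 1 nodes, folded at its
  midpoint: the value 1 there is shared equally by the two ends of the fork.\<close>

lemma dynkin_tree_D:
  assumes "odd N" "2 \<le> N"
  shows "dynkin_tree (N + 2) (cartan_D (N + 2)) (2 * N + 2)
    (\<lambda>i. if i = N + 1 then N + 2 else if i = N + 2 then N + 1 else i) id
    (\<lambda>i. if i \<le> N then sin (real i * (pi / real (2 * N + 2))) else 1 / 2)"
    (is "dynkin_tree _ _ _ ?\<tau> _ ?v")
proof
  fix i assume i: "i \<in> {1..N + 2}"
  show "(\<forall>j\<in>{1..N + 2}. id i \<le> id j) \<or>
      (\<exists>p\<in>{1..N + 2}. {j \<in> nb (N + 2) (cartan_D (N + 2)) i. id j < id i} = {p})"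
  proof (cases "i = 1")
    case False
    define p where "p = (if i \<le> N then i - 1 else N)"
    have "{j \<in> nb (N + 2) (cartan_D (N + 2)) i. id j < id i} = {p}"
      using i False assms(2) by (subst nb_D) (auto simp: p_def)
    moreover have "p \<in> {1..N + 2}" using i False assms(2) by (auto simp: p_def)
    ultimately show ?thesis by blast
  qed auto
  define \<theta> where "\<theta> = pi / real (2 * N + 2)"
  have "i * \<theta> < pi" if "i \<le> N"
  proof -
    have "real i / (2 * N + 2) < 1" using that by simp
    from mult_strict_left_mono[OF this pi_gt_zero] show ?thesis
      by (simp add: \<theta>_def mult.commute)
  qed
  moreover have "0 < i * \<theta>" using i by (simp add: \<theta>_def)
  ultimately have "sin (i * \<theta>) \<noteq> 0" if "i \<le> N" using that sin_gt_zero[of "i * \<theta>"] by auto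
  then show "?v i \<noteq> 0" unfolding \<theta>_def by simp
  have N1: "real (N + 1) * \<theta> = pi / 2" by (simp add: \<theta>_def field_simps)
  moreover have "real (N + 1) * \<theta> = real N * \<theta> + \<theta>" by (simp add: distrib_right)
  ultimately have "real N * \<theta> = pi / 2 - \<theta>" by linarith
  then have sN: "sin (real N * \<theta>) = cos \<theta>" by (simp add: cos_sin_eq)
  have sN1: "sin (real (N + 1) * \<theta>) = 1" unfolding N1 by simp
  have "(\<Sum>j\<in>nb (N + 2) (cartan_D (N + 2)) i. ?v j) = 2 * cos \<theta> * ?v i"
  proof (subst sum_nb_D)
    show "(if i < N then ?v (i - 1) + ?v (i + 1)
       else if i = N then ?v (N - 1) + ?v (N + 1) + ?v (N + 2) else ?v N) = 2 * cos \<theta> * ?v i"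
      using sin_neighbours[of "real i" \<theta>] i sN sN1 unfolding \<theta>_def[symmetric]
      by (auto simp: of_nat_diff add_ac)
  qed (use assms i in auto)
  then show "(\<Sum>j\<in>nb (N + 2) (cartan_D (N + 2)) i. ?v j) = 2 * cos (pi / real (2 * N + 2)) * ?v i"
    by (simp add: \<theta>_def)
next
  fix Y :: "nat \<Rightarrow> int \<Rightarrow> real" and i t
  assume Y: "wave (N + 2) (cartan_D (N + 2)) Y" and i: "i \<in> {1..N + 2}"
  define Y0 where "Y0 = Y(0 := \<lambda>_. 0)"
  have Y0: "Y0 i t + Y0 i (t + 2) =
      (if i < N then Y0 (i - 1) (t + 1) + Y0 (i + 1) (t + 1)
       else if i = N then Y0 (N - 1) (t + 1) + Y0 (N + 1) (t + 1) + Y0 (N + 2) (t + 1)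
       else Y0 N (t + 1))"
    if i: "i \<in> {1..N + 2}" for i t
  proof -
    have "(\<Sum>j\<in>nb (N + 2) (cartan_D (N + 2)) i. Y j (t + 1)) =
        (\<Sum>j\<in>nb (N + 2) (cartan_D (N + 2)) i. Y0 j (t + 1))"
      by (intro sum.cong) (auto simp: Y0_def nb_def)
    also have "\<dots> = (if i < N then Y0 (i - 1) (t + 1) + Y0 (i + 1) (t + 1)
       else if i = N then Y0 (N - 1) (t + 1) + Y0 (N + 1) (t + 1) + Y0 (N + 2) (t + 1)
       else Y0 N (t + 1))"
      using assms i by (subst sum_nb_D) (auto simp: Y0_def)
    finally show ?thesis using Y i by (simp add: wave_def Y0_def)
  qed
  \<comment> \<open>The sum over the two ends of the fork is the midpoint of a symmetric solution in type \<open>A\<close>;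
    the difference \<open>D\<close> below changes sign under \<open>t \<mapsto> t + 2\<close>, hence is fixed by the shift \<open>2 N + 2\<close>
    as \<open>N\<close> is odd.\<close>
  define Z where "Z k t = (if k \<le> N then Y0 k t else if k = N + 1 then Y0 (N + 1) t + Y0 (N + 2) t
    else Y0 (2 * N + 2 - k) t)" for k t
  have Z: "Z k (t + int (Suc (2 * N + 1))) = - Z (Suc (2 * N + 1) - k) t" if "k \<le> Suc (2 * N + 1)" for k t
  proof (rule dirichlet_wave)
    fix k t assume k: "k \<in> {1..2 * N + 1}"
    consider "k < N" | "k = N" | "k = N + 1" | "k = N + 2" | "N + 2 < k" by linarith
    then show "Z k t + Z k (t + 2) = Z (k - 1) (t + 1) + Z (k + 1) (t + 1)"
    proof cases
      case 1
      then have "k - 1 \<le> N" "k + 1 \<le> N" by auto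
      then show ?thesis using 1 Y0[of k t] k by (simp add: Z_def)
    next
      case 2
      then have "k - 1 \<le> N" by auto
      then show ?thesis using 2 Y0[of N t] k by (simp add: Z_def)
    next
      case 3
      then show ?thesis using Y0[of "N + 1" t] Y0[of "N + 2" t] by (simp add: Z_def)
    next
      case 4
      then show ?thesis using Y0[of N t] assms(2) by (simp add: Z_def)
    next
      case 5
      define l where "l = 2 * N + 2 - k"
      have l: "1 \<le> l" "l < N" "2 * N + 2 - (k - 1) = l + 1" "2 * N + 2 - (k + 1) = l - 1"
        using 5 k by (auto simp: l_def)
      have "\<not> k \<le> N" "k \<noteq> N + 1" "\<not> k - 1 \<le> N" "k - 1 \<noteq> N + 1" "\<not> k + 1 \<le> N" "k + 1 \<noteq> N + 1"
        using 5 by linarith+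
      then have "Z k = Y0 l" "Z (k - 1) = Y0 (l + 1)" "Z (k + 1) = Y0 (l - 1)"
        unfolding Z_def by (simp_all only: if_False l(3,4) l_def[symmetric])
      then show ?thesis using Y0[of l t] l(1,2) by simp
    qed
  next
    fix s
    show "Z 0 s = 0" by (simp add: Z_def Y0_def)
    have "\<not> Suc (2 * N + 1) \<le> N" "Suc (2 * N + 1) \<noteq> N + 1" "2 * N + 2 - Suc (2 * N + 1) = 0"
      by linarith+
    then have "Z (Suc (2 * N + 1)) s = Y0 0 s" unfolding Z_def by (simp only: if_False)
    then show "Z (Suc (2 * N + 1)) s = 0" by (simp add: Y0_def)
  qed (rule that)
  show "Y i (t + int (2 * N + 2)) = - Y (?\<tau> i) t"
  proof (cases "i \<le> N")
    case True
    have "Z (2 * N + 2 - i) t = Y0 i t" using True i assms by (auto simp: Z_def)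
    then show ?thesis using True i Z[of i t] by (simp add: Z_def Y0_def)
  next
    case False
    define D where "D t = Y (N + 2) t - Y (N + 1) t" for t
    have D2: "D (t + 2) = - D t" for t
      using Y0[of "N + 1" t] Y0[of "N + 2" t] by (simp add: D_def Y0_def)
    have "D (t + 4 * int k) = D t" for k t
    proof (induction k)
      case (Suc k)
      then show ?case using D2[of "t + 4 * int k"] D2[of "t + 4 * int k + 2"]
        by (simp add: algebra_simps)
    qed simp
    moreover obtain m where "N = 2 * m + 1" using assms by (elim oddE)
    ultimately have D: "D (t + int (2 * N + 2)) = D t"
      using \<open>\<And>t k. D (t + 4 * int k) = D t\<close>[of t "Suc m"] by (simp add: algebra_simps)
    have "Y (N + 1) (t + int (2 * N + 2)) + Y (N + 2) (t + int (2 * N + 2)) =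
        - (Y (N + 1) t + Y (N + 2) t)"
      using Z[of "N + 1" t] by (simp add: Z_def Y0_def)
    moreover have "i = N + 1 \<or> i = N + 2" using False i by auto
    ultimately show ?thesis using D unfolding D_def by auto
  qed
next
  fix i j
  let ?C = "cartan_D (N + 2)"
  show "?C i j = ?C j i" unfolding cartan_D_def by (rule simply_laced_matrix_sym)
  assume "i \<noteq> j"
  then show "?C i j \<in> {0, - 1}" unfolding cartan_D_def by (rule simply_laced_matrix_offdiag)
next
  fix i j
  have "edge_D N (?\<tau> i) (?\<tau> j) \<or> edge_D N (?\<tau> j) (?\<tau> i) \<longleftrightarrow> edge_D N i j \<or> edge_D N j i"
    by (simp add: edge_D_def) (use assms(2) in presburger)
  moreover have "?\<tau> i = ?\<tau> j \<longleftrightarrow> i = j" by simp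
  ultimately show "cartan_D (N + 2) (?\<tau> i) (?\<tau> j) = cartan_D (N + 2) i j"
    unfolding cartan_D_edge by argo
qed (use assms(2) in auto)

section \<open>Type E6\<close>

lemma nb_E6:
  "nb 6 cartan_E6 1 = {3}" "nb 6 cartan_E6 2 = {4}" "nb 6 cartan_E6 3 = {1, 4}"
  "nb 6 cartan_E6 4 = {2, 3, 5}" "nb 6 cartan_E6 5 = {4, 6}" "nb 6 cartan_E6 6 = {5}"
  by (auto simp: nb_def cartan_E6_def simply_laced_matrix_def)

lemma dynkin_tree_E6: "\<exists>\<tau> \<rho> v. dynkin_tree 6 cartan_E6 12 \<tau> \<rho> v"
proof -
  \<comment> \<open>Nodes are numbered from 1, so entry 0 of each list is padding.\<close>
  define \<tau> :: "nat \<Rightarrow> nat" where "\<tau> i = [0, 6, 2, 5, 4, 3, 1] ! i" for i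
  define s where "s k = sin (real k * (pi / 12))" for k :: nat
  \<comment> \<open>The two long arms carry \<open>s 1\<close>, \<open>s 2\<close>,
    \<open>s 3\<close> as in type A with h = 12. The equation at the branch node 4 then forces
    \<open>s 4 - s 2\<close> at node 2.\<close>
  define v where "v i = [0, s 1, s 4 - s 2, s 2, s 3, s 2, s 1] ! i" for i
  have R: "{1..6} = {1, 2, 3, 4, 5, 6 :: nat}" by auto
  have s: "s k + s (k + 2) = 2 * cos (pi / 12) * s (k + 1)" for k
    using sin_neighbours[of "real (k + 1)" "pi / 12"] by (simp add: s_def add_ac)
  have s02: "s 0 + s 2 = 2 * cos (pi / 12) * s 1"
    using s[of 0] by (simp add: numeral_2_eq_2)
  have s1: "s 1 + s 3 = 2 * cos (pi / 12) * s 2"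
    "s 2 + s 4 = 2 * cos (pi / 12) * s 3" "s 3 + s 5 = 2 * cos (pi / 12) * s 4"
    using s[of 1] s[of 2] s[of 3] by simp_all
  have s0: "s 0 = 0" by (simp add: s_def)
  have s3: "s 3 = sqrt 2 / 2" using sin_45 by (simp add: s_def)
  have s2: "s 2 = 1 / 2" using sin_30 by (simp add: s_def)
  have s4: "s 4 = sqrt 3 / 2" using sin_60 by (simp add: s_def)
  \<comment> \<open>This is the eigenvalue equation at node 2, since 2 cos(pi/12) (s 4 - s 2) = s 5
    - s 1.\<close>
  have s51: "s 5 - s 1 = s 3"
  proof -
    have "s 5 = sin (pi / 4) * cos (pi / 6) + cos (pi / 4) * sin (pi / 6)"
      "s 1 = sin (pi / 4) * cos (pi / 6) - cos (pi / 4) * sin (pi / 6)"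
      unfolding sin_add[symmetric] sin_diff[symmetric] by (simp_all add: s_def)
    then show ?thesis using s3 by (simp add: cos_45 sin_30)
  qed
  have "0 < s 1" by (auto simp: s_def intro: sin_gt_zero)
  \<comment> \<open>The ranks count down from the root 6: in the order of the labels, node 4 would
    have the two lower neighbours 2 and 3.\<close>
  have "dynkin_tree 6 cartan_E6 12 \<tau> (\<lambda>i. 6 - i) v"
  proof
    fix i j :: nat assume "i \<in> {1..6}" "j \<in> {1..6}"
    then show "cartan_E6 (\<tau> i) (\<tau> j) = cartan_E6 i j"
      unfolding R by (elim insertE emptyE) (simp_all add: \<tau>_def cartan_E6_def simply_laced_matrix_def)
  next
    fix i :: nat assume i: "i \<in> {1..6}"
    show "\<tau> i \<in> {1..6}" using i unfolding R by (elim insertE emptyE) (simp_all add: \<tau>_def)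
    show "\<tau> (\<tau> i) = i" using i unfolding R by (elim insertE emptyE) (simp_all add: \<tau>_def)
    show "(\<forall>j\<in>{1..6}. 6 - i \<le> 6 - j) \<or> (\<exists>p\<in>{1..6}. {j \<in> nb 6 cartan_E6 i. 6 - j < 6 - i} = {p})"
    proof (cases "i = 6")
      case False
      have "{j \<in> nb 6 cartan_E6 i. 6 - j < 6 - i} = {[0 :: nat, 3, 4, 4, 5, 6] ! i}"
        using i False unfolding R by (elim insertE emptyE) (auto simp: nb_E6)
      moreover have "[0 :: nat, 3, 4, 4, 5, 6] ! i \<in> {1..6}"
        using i False unfolding R by (elim insertE emptyE) auto
      ultimately show ?thesis by blast
    qed simp
    show "v i \<noteq> 0"
      using i \<open>0 < s 1\<close> s2 s3 s4 unfolding R by (elim insertE emptyE) (auto simp: v_def)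
    show "(\<Sum>j\<in>nb 6 cartan_E6 i. v j) = 2 * cos (pi / real 12) * v i"
      using i unfolding R
    proof (elim insertE emptyE, simp_all add: nb_E6 v_def right_diff_distrib)
    qed (use s02 s1 s0 s51 in linarith)+
  next
    fix Y :: "nat \<Rightarrow> int \<Rightarrow> real" and i :: nat and t
    assume Y: "wave 6 cartan_E6 Y" and i: "i \<in> {1..6}"
    have Y': "Y 1 t + Y 1 (t + 2) = Y 3 (t + 1)" "Y 2 t + Y 2 (t + 2) = Y 4 (t + 1)"
      "Y 3 t + Y 3 (t + 2) = Y 1 (t + 1) + Y 4 (t + 1)"
      "Y 4 t + Y 4 (t + 2) = Y 2 (t + 1) + Y 3 (t + 1) + Y 5 (t + 1)"
      "Y 5 t + Y 5 (t + 2) = Y 4 (t + 1) + Y 6 (t + 1)" "Y 6 t + Y 6 (t + 2) = Y 5 (t + 1)" for t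
      using Y unfolding wave_def R by (simp_all add: nb_E6)
    \<comment> \<open>The unfolding onto type \<open>A\<close> with 11 nodes: \<open>Z (k + 1) t = Z k (t + 1) + Z k (t - 1) - Z (k - 1) t\<close>
      from \<open>Z 0 = 0\<close> and \<open>Z 1 = Y 1\<close>, which vanishes again at \<open>k = 12\<close>.\<close>
    define Z where "Z k t = [0, Y 1 t, Y 3 t, Y 4 t, Y 5 t + Y 2 t, Y 6 t + Y 4 t, Y 3 t + Y 5 t,
      Y 4 t + Y 1 t, Y 2 t + Y 3 t, Y 4 t, Y 5 t, Y 6 t, 0] ! k" for k t
    have Z: "Z k (t + int (Suc 11)) = - Z (Suc 11 - k) t" if "k \<le> Suc 11" for k t
    proof (rule dirichlet_wave)
      fix k t assume "k \<in> {1..11 :: nat}"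
      then have "k \<in> {1, 2, 3, 4, 5, 6, 7, 8, 9, 10, 11}"
        unfolding atLeastAtMost_iff insert_iff empty_iff by presburger
      then show "Z k t + Z k (t + 2) = Z (k - 1) (t + 1) + Z (k + 1) (t + 1)"
      proof (elim insertE emptyE, simp_all add: Z_def)
      qed (use Y'[of t] in linarith)+
    qed (use that in \<open>simp_all add: Z_def\<close>)
    \<comment> \<open>Nodes 1, 3, 4, 5, 6 occur alone at the positions 1, 2, 3, 10, 11 of
      \<open>Z\<close>. Node 2 is obtained from position 4 by subtracting the known value at node
      5.\<close>
    show "Y i (t + int 12) = - Y (\<tau> i) t"
      using i Z[of 1 t] Z[of 2 t] Z[of 3 t] Z[of 4 t] Z[of 10 t] Z[of 11 t]
      unfolding R by (elim insertE emptyE) (simp_all add: Z_def \<tau>_def)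
  next
    fix i j
    show "cartan_E6 i j = cartan_E6 j i" unfolding cartan_E6_def by (rule simply_laced_matrix_sym)
    assume "i \<noteq> j"
    then show "cartan_E6 i j \<in> {0, - 1}" unfolding cartan_E6_def by (rule simply_laced_matrix_offdiag)
  next
    show "inj_on (\<lambda>i. 6 - i) {1..6 :: nat}" by (auto simp: inj_on_def)
  qed simp_all
  then show ?thesis by blast
qed

section \<open>Orbits of the fundamental weights under the Coxeter element\<close>

locale coxeter_heights =
  based_root_system \<Phi> r \<alpha> + dynkin_tree r A h \<tau> \<rho> v
  for \<Phi> :: "'a::euclidean_space set" and r \<alpha> A h \<tau> \<rho> v +
  fixes \<xi> :: "nat \<Rightarrow> int"
  assumes cartan: "cartan_matrix_of r \<alpha> A"
    and height: "\<And>i j. i \<in> {1..r} \<Longrightarrow> j \<in> nb r A i \<Longrightarrow> i < j \<Longrightarrow> \<xi> j = \<xi> i + 1"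
begin

abbreviation c :: "'a \<Rightarrow> 'a" where "c \<equiv> coxeter_element r \<alpha>"

section \<open>Mesh relations and the wave of a Coxeter element\<close>

lemma height_nb:
  assumes "i \<in> {1..r}" "j \<in> nb r A i"
  shows "\<xi> j = (if j < i then \<xi> i - 1 else \<xi> i + 1)"
proof -
  have "j \<in> {1..r}" "j \<noteq> i" using assms(2) by (auto simp: nb_def)
  then show ?thesis
    using height[OF assms] height[OF _ nb_sym[OF assms]] by auto
qed

lemma simple_expand:
  assumes i: "i \<in> {1..r}"
  shows "\<alpha> i = 2 *\<^sub>R \<omega> i - (\<Sum>j\<in>nb r A i. \<omega> j)"
proof -
  have A_ii: "real_of_int (A i i) = 2"
    using cartan i coroot_self[OF simple_nonzero[OF i]] by (auto simp: cartan_matrix_of_def)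
  have "\<alpha> i = (\<Sum>j\<in>{1..r}. real_of_int (A i j) *\<^sub>R \<omega> j)"
  proof (subst expand_fund_weight, rule sum.cong)
    fix j assume "j \<in> {1..r}"
    then show "(coroot (\<alpha> j) \<bullet> \<alpha> i) *\<^sub>R \<omega> j = real_of_int (A i j) *\<^sub>R \<omega> j"
      using cartan i sym[OF i] by (simp add: cartan_matrix_of_def)
  qed simp
  also have "\<dots> = real_of_int (A i i) *\<^sub>R \<omega> i + (\<Sum>j\<in>{1..r} - {i}. real_of_int (A i j) *\<^sub>R \<omega> j)"
    using i by (intro sum.remove) auto
  also have "(\<Sum>j\<in>{1..r} - {i}. real_of_int (A i j) *\<^sub>R \<omega> j)
      = (\<Sum>j\<in>nb r A i. real_of_int (A i j) *\<^sub>R \<omega> j)"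
    by (rule sum.mono_neutral_right) (auto simp: nb_def)
  also have "\<dots> = (\<Sum>j\<in>nb r A i. - \<omega> j)"
  proof (rule sum.cong)
    fix j assume "j \<in> nb r A i"
    then have "A i j = -1" using offdiag[OF i] by (auto simp: nb_def)
    then show "real_of_int (A i j) *\<^sub>R \<omega> j = - \<omega> j" by simp
  qed simp
  finally show ?thesis by (simp add: A_ii sum_negf)
qed

text \<open>The letters to the right of \<open>j\<close> fix \<omega>_j, so every prefix containing
  \<open>j\<close> acts on it as the whole of \<open>c\<close>.\<close>

lemma prefix_fund_weight:
  assumes "i \<in> {1..r}" "j \<in> {1..r}"
  shows "word_prod \<alpha> [1..<i] (\<omega> j) = (if j < i then c (\<omega> j) else \<omega> j)"
proof (cases "j < i")
  case True
  have split: "word_prod \<alpha> [1..<k] (\<omega> j) = word_prod \<alpha> [1..<Suc j] (\<omega> j)"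
    if "j < k" "k \<le> Suc r" for k
  proof -
    have "[1..<k] = [1..<Suc j] @ [Suc j..<k]"
      using that assms(2) upt_add_eq_append[of 1 "Suc j" "k - Suc j"] by simp
    moreover have "word_prod \<alpha> [Suc j..<k] (\<omega> j) = \<omega> j"
      using that assms(2) by (intro word_prod_fix_fund_weight) auto
    ultimately show ?thesis by simp
  qed
  show ?thesis
    using split[of i] split[of "Suc r"] True assms by (auto simp: coxeter_element_def)
next
  case False
  then have "word_prod \<alpha> [1..<i] (\<omega> j) = \<omega> j"
    using assms by (intro word_prod_fix_fund_weight) auto
  then show ?thesis using False by simp
qed

lemma coxeter_fund_weight:
  assumes i: "i \<in> {1..r}"
  shows "\<omega> i - c (\<omega> i) = word_prod \<alpha> [1..<i] (\<alpha> i)"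
proof -
  have "[1..<Suc r] = [1..<i] @ [i] @ [Suc i..<Suc r]"
    using i upt_add_eq_append[of 1 i "Suc r - i"] upt_conv_Cons[of i "Suc r"] by simp
  moreover have "word_prod \<alpha> [Suc i..<Suc r] (\<omega> i) = \<omega> i"
    using i by (intro word_prod_fix_fund_weight) auto
  ultimately have "c (\<omega> i) = word_prod \<alpha> [1..<i] (\<omega> i - \<alpha> i)"
    using i by (simp add: coxeter_element_def refl_fund_weight)
  then show ?thesis using prefix_fund_weight[OF i i] by (simp add: word_prod_diff)
qed

text \<open>Apply the prefix s_1 ... s_(i-1) to \<alpha>_i = 2 \<omega>_i - (sum of the neighbouring
  weights); \<open>prefix_fund_weight\<close> inserts \<open>c\<close> exactly at the neighbours
  below \<open>i\<close>.\<close>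

lemma mesh:
  assumes i: "i \<in> {1..r}"
  shows "\<omega> i + c (\<omega> i) = (\<Sum>j\<in>nb r A i. if j < i then c (\<omega> j) else \<omega> j)"
proof -
  have "word_prod \<alpha> [1..<i] (\<alpha> i) = 2 *\<^sub>R \<omega> i - (\<Sum>j\<in>nb r A i. word_prod \<alpha> [1..<i] (\<omega> j))"
    using prefix_fund_weight[OF i i]
    by (subst simple_expand[OF i]) (simp add: word_prod_diff word_prod_sum word_prod_scale)
  also have "(\<Sum>j\<in>nb r A i. word_prod \<alpha> [1..<i] (\<omega> j)) =
      (\<Sum>j\<in>nb r A i. if j < i then c (\<omega> j) else \<omega> j)"
    by (intro sum.cong) (auto simp: nb_def prefix_fund_weight[OF i])
  finally have "(\<Sum>j\<in>nb r A i. if j < i then c (\<omega> j) else \<omega> j) =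
      \<omega> i + \<omega> i - (\<omega> i - c (\<omega> i))"
    by (simp add: coxeter_fund_weight[OF i] scaleR_2)
  then show ?thesis by simp
qed

definition c_inv :: "'a \<Rightarrow> 'a" where
  "c_inv = word_prod \<alpha> (rev [1..<Suc r])"

lemma c_inv_c [simp]: "c_inv (c x) = x"
  by (simp add: c_inv_def coxeter_element_def del: upt_Suc)

lemma linear_c: "linear c"
  by (simp add: coxeter_element_def linear_word_prod)

lemma linear_c_inv: "linear c_inv"
  by (simp add: c_inv_def linear_word_prod)

lemma linear_funpow: "linear f \<Longrightarrow> linear (f ^^ n)" for f :: "'a \<Rightarrow> 'a"
proof (induction n)
  case (Suc n)
  then show ?case unfolding funpow.simps(2) using linear_compose by blast
qed (simp add: linear_iff)

lemma funpow_c_inj: "(c ^^ k) x = (c ^^ k) y \<Longrightarrow> x = y"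
  by (induction k) (simp_all, metis c_inv_c)

text \<open>The wave equation is imposed at all integer times, so negative powers of
  \<open>c\<close> are needed as well.\<close>

definition cpow :: "int \<Rightarrow> 'a \<Rightarrow> 'a" where
  "cpow k = (if 0 \<le> k then c ^^ nat k else c_inv ^^ nat (- k))"

lemma linear_cpow: "linear (cpow k)"
  by (simp add: cpow_def linear_funpow linear_c linear_c_inv)

lemma cpow_c: "cpow k (c x) = cpow (k + 1) x"
proof (cases "0 \<le> k")
  case True
  then have "nat (k + 1) = Suc (nat k)" by simp
  then show ?thesis using True by (simp add: cpow_def funpow_swap1)
next
  case False
  then have "nat (- k) = Suc (nat (- (k + 1)))" by simp
  then have "cpow k (c x) = (c_inv ^^ nat (- (k + 1))) x"
    using False by (simp add: cpow_def funpow_Suc_right del: funpow.simps(2))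
  also have "\<dots> = cpow (k + 1) x" using False by (cases "k = -1") (auto simp: cpow_def)
  finally show ?thesis .
qed

text \<open>The powers of \<open>c\<close> on fundamental weights, reparametrised so that the mesh relations no longer
  depend on the orientation.\<close>

definition Y :: "nat \<Rightarrow> int \<Rightarrow> 'a" where
  "Y i t = (if even (t - \<xi> i) then cpow ((t - \<xi> i) div 2) (\<omega> i) else 0)"

lemma Y_height: "Y i (\<xi> i + 2 * k) = cpow k (\<omega> i)"
  by (simp add: Y_def)

lemma Y_height_nat: "Y i (\<xi> i + 2 * int k) = (c ^^ k) (\<omega> i)"
  by (simp add: Y_height cpow_def)

lemma wave_Y: "wave r A Y"
  unfolding wave_def
proof (intro ballI allI)
  fix i t assume i: "i \<in> {1..r}"
  show "Y i t + Y i (t + 2) = (\<Sum>j\<in>nb r A i. Y j (t + 1))"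
  proof (cases "even (t - \<xi> i)")
    case True
    define k where "k = (t - \<xi> i) div 2"
    have t: "t = \<xi> i + 2 * k" using True by (simp add: k_def)
    have "Y i t + Y i (t + 2) = cpow k (\<omega> i) + cpow (k + 1) (\<omega> i)"
      using Y_height[of i k] Y_height[of i "k + 1"] by (simp add: t algebra_simps)
    also have "\<dots> = cpow k (\<omega> i + c (\<omega> i))"
      by (simp add: linear_add[OF linear_cpow] cpow_c)
    also have "\<dots> = (\<Sum>j\<in>nb r A i. cpow k (if j < i then c (\<omega> j) else \<omega> j))"
      by (simp only: mesh[OF i] linear_sum[OF linear_cpow])
    also have "\<dots> = (\<Sum>j\<in>nb r A i. Y j (t + 1))"
    proof (rule sum.cong)
      fix j assume j: "j \<in> nb r A i"
      have "t + 1 = (if j < i then \<xi> j + 2 * (k + 1) else \<xi> j + 2 * k)"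
        using height_nb[OF i j] by (simp add: t)
      then show "cpow k (if j < i then c (\<omega> j) else \<omega> j) = Y j (t + 1)"
        by (simp only: Y_height cpow_c split: if_split) simp
    qed simp
    finally show ?thesis .
  next
    case False
    have "Y j (t + 1) = 0" if j: "j \<in> nb r A i" for j
    proof -
      have "\<xi> j = \<xi> i - 1 \<or> \<xi> j = \<xi> i + 1" using height_nb[OF i j] by presburger
      then have "odd (t + 1 - \<xi> j)" using False by presburger
      then show ?thesis by (simp add: Y_def)
    qed
    then show ?thesis using False by (simp add: Y_def)
  qed
qed

lemma Y_half_period:
  assumes i: "i \<in> {1..r}"
  shows "Y i (t + int h) = - Y (\<tau> i) t"
proof -
  have "u \<bullet> Y i (t + int h) = u \<bullet> (- Y (\<tau> i) t)" for u
  proof -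
    have "wave r A (\<lambda>i t. u \<bullet> Y i t)"
      using wave_Y unfolding wave_def by (metis inner_add_right inner_sum_right)
    from half_period[OF this i] show ?thesis by simp
  qed
  then show ?thesis using vector_eq_ldot by blast
qed

text \<open>With the wrong parity, the default value 0 of \<open>Y\<close> would be equated with
  -\<omega> at the node \<open>\<tau> i\<close>, which is nonzero.\<close>

lemma height_\<tau>_parity:
  assumes i: "i \<in> {1..r}"
  shows "even (\<xi> (\<tau> i) + int h - \<xi> i)"
proof (rule ccontr)
  assume "odd (\<xi> (\<tau> i) + int h - \<xi> i)"
  then have "Y i (\<xi> (\<tau> i) + int h) = 0" by (simp add: Y_def)
  then have "Y (\<tau> i) (\<xi> (\<tau> i) + 2 * 0) = 0" using Y_half_period[OF i, of "\<xi> (\<tau> i)"] by simp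
  then have "\<omega> (\<tau> i) = 0" unfolding Y_height by (simp add: cpow_def)
  then show False using fund_weight_nonzero \<tau>_in[OF i] by blast
qed

lemma height_\<tau>_bound:
  assumes i: "i \<in> {1..r}"
  shows "\<bar>\<xi> (\<tau> i) - \<xi> i\<bar> < int h"
proof -
  obtain p where "dynkin_path r A i (\<tau> i) p" using ex1_path[OF i \<tau>_in[OF i]] by blast
  from heights_along_path(2)[where \<xi> = \<xi> and A = A and r = r, OF height sym this] rank_less show ?thesis by linarith
qed

text \<open>The number m_i of the theorem, with the height difference in place of a_i - b_i. The two
  preceding lemmas make the division exact and its result positive.\<close>

definition m :: "nat \<Rightarrow> nat" where
  "m i = nat ((\<xi> (\<tau> i) + int h - \<xi> i) div 2)"

lemma m_eq: "i \<in> {1..r} \<Longrightarrow> 2 * int (m i) = \<xi> (\<tau> i) + int h - \<xi> i"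
  using height_\<tau>_parity height_\<tau>_bound[of i] by (simp add: m_def)

lemma m_pos: "i \<in> {1..r} \<Longrightarrow> 1 \<le> m i"
  using m_eq[of i] height_\<tau>_bound[of i] by linarith

lemma m_\<tau>: "i \<in> {1..r} \<Longrightarrow> m i + m (\<tau> i) = h"
  using m_eq[of i] m_eq[of "\<tau> i"] \<tau>_in[of i] \<tau>_\<tau>[of i] by simp

lemma c_m:
  assumes i: "i \<in> {1..r}"
  shows "(c ^^ m i) (\<omega> i) = - \<omega> (\<tau> i)"
proof -
  have "\<xi> i + 2 * int (m i) = \<xi> (\<tau> i) + 2 * 0 + int h" using m_eq[OF i] by simp
  then have "(c ^^ m i) (\<omega> i) = Y i (\<xi> (\<tau> i) + 2 * 0 + int h)" by (metis Y_height_nat)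
  also have "\<dots> = - \<omega> (\<tau> i)" unfolding Y_half_period[OF i] Y_height by (simp add: cpow_def)
  finally show ?thesis .
qed

text \<open>Replacing \<open>t i\<close> by \<open>t i - 2\<close> at a local maximum \<open>i\<close> of \<open>t\<close> amounts to cancelling a factor
  \<open>s i\<close> on the right; any height function above \<open>\<xi>\<close> descends to \<open>\<xi>\<close> in this way.\<close>

lemma exists_weyl_heights:
  assumes step: "\<And>i j. i \<in> {1..r} \<Longrightarrow> j \<in> nb r A i \<Longrightarrow> \<bar>t i - t j\<bar> = 1"
    and ge: "\<And>i. i \<in> {1..r} \<Longrightarrow> \<xi> i \<le> t i" and par: "\<And>i. i \<in> {1..r} \<Longrightarrow> even (t i - \<xi> i)"
  shows "\<exists>ws. set ws \<subseteq> {1..r} \<and> (\<forall>i\<in>{1..r}. word_prod \<alpha> ws (\<omega> i) = Y i (t i))"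
  using step ge par
proof (induction "nat (\<Sum>i\<in>{1..r}. t i - \<xi> i)" arbitrary: t rule: less_induct)
  case less
  define B where "B = {i \<in> {1..r}. \<xi> i < t i}"
  show ?case
  proof (cases "B = {}")
    case True
    have "t i = \<xi> i + 2 * 0" if "i \<in> {1..r}" for i
      using True less.prems(2)[OF that] that by (force simp: B_def)
    then show ?thesis
      by (intro exI[of _ "[]"]) (auto simp: Y_height cpow_def simp del: mult_zero_right)
  next
    case False
    have fin: "finite B" by (simp add: B_def)
    obtain i where i: "i \<in> B" and imax: "\<And>j. j \<in> B \<Longrightarrow> t j \<le> t i"
    proof -
      have "Max (t ` B) \<in> t ` B" using fin False by (intro Max_in) auto
      then obtain i where "i \<in> B" "t i = Max (t ` B)" by auto
      then show ?thesis using that fin by (metis Max_ge finite_imageI image_eqI)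
    qed
    have iR: "i \<in> {1..r}" and gt: "\<xi> i < t i" using i by (auto simp: B_def)
    \<comment> \<open>A neighbour above \<open>t i\<close> would lie outside \<open>B\<close>, hence
      at its base height, which is at most \<xi> i + 1 < t i + 1.\<close>
    have nbi: "t j = t i - 1" if j: "j \<in> nb r A i" for j
    proof (rule ccontr)
      assume "t j \<noteq> t i - 1"
      then have tj: "t j = t i + 1" using less.prems(1)[OF iR j] by linarith
      have jR: "j \<in> {1..r}" using j by (simp add: nb_def)
      have "j \<notin> B" using imax tj by fastforce
      then have "\<xi> j = t j" using less.prems(2)[OF jR] jR by (force simp: B_def)
      then show False using tj gt height_nb[OF iR j] by (auto split: if_splits)
    qed
    define t' where "t' = t(i := t i - 2)"
    have ge': "\<xi> i \<le> t i - 2" using gt less.prems(3)[OF iR] by presburger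
    have "\<exists>ws. set ws \<subseteq> {1..r} \<and> (\<forall>i\<in>{1..r}. word_prod \<alpha> ws (\<omega> i) = Y i (t' i))"
    proof (rule less.hyps)
      have "(\<Sum>j\<in>{1..r}. t' j - \<xi> j) < (\<Sum>j\<in>{1..r}. t j - \<xi> j)"
        using iR by (intro sum_strict_mono_ex1) (auto simp: t'_def)
      moreover have "0 \<le> (\<Sum>j\<in>{1..r}. t' j - \<xi> j)"
        using ge' less.prems(2) by (intro sum_nonneg) (auto simp: t'_def)
      ultimately show "nat (\<Sum>j\<in>{1..r}. t' j - \<xi> j) < nat (\<Sum>j\<in>{1..r}. t j - \<xi> j)" by linarith
    next
      fix k j assume k: "k \<in> {1..r}" and j: "j \<in> nb r A k"
      have "j \<noteq> k" using j by (simp add: nb_def)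
      then show "\<bar>t' k - t' j\<bar> = 1"
        using nbi nb_sym[OF k j] j less.prems(1)[OF k j] by (auto simp: t'_def)
    next
      fix j assume "j \<in> {1..r}"
      then show "\<xi> j \<le> t' j" "even (t' j - \<xi> j)"
        using ge' less.prems(2,3) iR by (auto simp: t'_def)
    qed
    then obtain ws where ws: "set ws \<subseteq> {1..r}"
      "\<And>j. j \<in> {1..r} \<Longrightarrow> word_prod \<alpha> ws (\<omega> j) = Y j (t' j)" by blast
    have "word_prod \<alpha> (ws @ [i]) (\<omega> j) = Y j (t j)" if j: "j \<in> {1..r}" for j
    proof (cases "j = i")
      case False
      then show ?thesis using ws(2)[OF j] j iR by (simp add: refl_fund_weight t'_def)
    next
      case True
      have "word_prod \<alpha> (ws @ [i]) (\<omega> i) = word_prod \<alpha> ws (\<omega> i - \<alpha> i)"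
        using iR by (simp add: refl_fund_weight)
      also have "\<omega> i - \<alpha> i = (\<Sum>j\<in>nb r A i. \<omega> j) - \<omega> i"
        by (subst simple_expand[OF iR]) (simp add: scaleR_2)
      also have "word_prod \<alpha> ws \<dots> = (\<Sum>j\<in>nb r A i. word_prod \<alpha> ws (\<omega> j)) - word_prod \<alpha> ws (\<omega> i)"
        by (simp add: word_prod_diff word_prod_sum)
      also have "(\<Sum>j\<in>nb r A i. word_prod \<alpha> ws (\<omega> j)) = (\<Sum>j\<in>nb r A i. Y j (t i - 2 + 1))"
      proof (rule sum.cong)
        fix j assume j: "j \<in> nb r A i"
        then have "j \<in> {1..r}" "j \<noteq> i" by (auto simp: nb_def)
        then show "word_prod \<alpha> ws (\<omega> j) = Y j (t i - 2 + 1)"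
          using ws(2) nbi[OF j] by (simp add: t'_def)
      qed simp
      \<comment> \<open>The wave equation at time \<open>t i - 2\<close>; subtracting
        \<open>Y i (t i - 2)\<close> leaves the wanted \<open>Y i (t i)\<close>.\<close>
      also have "\<dots> = Y i (t i - 2) + Y i (t i - 2 + 2)"
        using wave_Y iR unfolding wave_def by metis
      finally show ?thesis using ws(2)[OF iR] True by (simp add: t'_def)
    qed
    then show ?thesis using ws(1) iR by (intro exI[of _ "ws @ [i]"]) auto
  qed
qed

text \<open>Heights shifted by h and twisted by the automorphism \<open>\<tau>\<close> are again
  admissible, so \<open>exists_weyl_heights\<close> gives a word realising the half period on all
  fundamental weights at once. It negates the simple roots up to \<open>\<tau>\<close>, hence is the
  longest element.\<close>

lemma longest_fund_weight:
  assumes i: "i \<in> {1..r}"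
  shows "longest_element r \<alpha> (\<omega> i) = - \<omega> (\<tau> i)"
proof -
  define t where "t i = \<xi> (\<tau> i) + int h" for i
  have "\<exists>ws. set ws \<subseteq> {1..r} \<and> (\<forall>i\<in>{1..r}. word_prod \<alpha> ws (\<omega> i) = Y i (t i))"
  proof (rule exists_weyl_heights)
    fix i j assume i: "i \<in> {1..r}" and j: "j \<in> nb r A i"
    show "\<bar>t i - t j\<bar> = 1"
      using height_nb[OF \<tau>_in[OF i] nb_\<tau>[OF i j]] unfolding t_def by presburger
  next
    fix i assume i: "i \<in> {1..r}"
    show "\<xi> i \<le> t i" using height_\<tau>_bound[OF i] by (simp add: t_def)
    show "even (t i - \<xi> i)" using height_\<tau>_parity[OF i] by (simp add: t_def)
  qed
  then obtain ws where ws: "set ws \<subseteq> {1..r}"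
    "\<And>i. i \<in> {1..r} \<Longrightarrow> word_prod \<alpha> ws (\<omega> i) = Y i (t i)" by blast
  have w: "word_prod \<alpha> ws (\<omega> i) = - \<omega> (\<tau> i)" if "i \<in> {1..r}" for i
    using ws(2)[OF that] Y_half_period[OF that, of "\<xi> (\<tau> i)"] Y_height[of "\<tau> i" 0]
    by (simp add: t_def cpow_def)
  have "longest_element r \<alpha> = word_prod \<alpha> ws"
  proof (rule longest_element_eq)
    fix j assume j: "j \<in> {1..r}"
    define i where "i = \<tau> j"
    have i: "i \<in> {1..r}" "\<tau> i = j" using \<tau>_in[OF j] \<tau>_\<tau>[OF j] by (simp_all add: i_def)
    have bij: "bij_betw \<tau> (nb r A i) (nb r A j)"
    proof (rule bij_betw_byWitness[where f' = \<tau>])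
      show "\<forall>k\<in>nb r A i. \<tau> (\<tau> k) = k" "\<forall>k\<in>nb r A j. \<tau> (\<tau> k) = k"
        using \<tau>_\<tau> unfolding nb_def by blast+
      show "\<tau> ` nb r A i \<subseteq> nb r A j" "\<tau> ` nb r A j \<subseteq> nb r A i"
        using nb_\<tau>[OF i(1)] nb_\<tau>[OF j] i by (auto simp: i_def)
    qed
    have "word_prod \<alpha> ws (\<alpha> i) = 2 *\<^sub>R word_prod \<alpha> ws (\<omega> i) - (\<Sum>k\<in>nb r A i. word_prod \<alpha> ws (\<omega> k))"
      by (subst simple_expand[OF i(1)]) (simp add: word_prod_diff word_prod_sum word_prod_scale)
    also have "(\<Sum>k\<in>nb r A i. word_prod \<alpha> ws (\<omega> k)) = (\<Sum>k\<in>nb r A i. - \<omega> (\<tau> k))"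
      by (intro sum.cong) (auto simp: w nb_def)
    also have "\<dots> = - (\<Sum>k\<in>nb r A j. \<omega> k)"
      using sum.reindex_bij_betw[OF bij, of \<omega>] by (simp add: sum_negf)
    finally have "word_prod \<alpha> ws (\<alpha> i) = - \<alpha> j"
      using w[OF i(1)] i(2) by (simp add: simple_expand[OF j])
    then show "\<exists>i\<in>{1..r}. word_prod \<alpha> ws (\<alpha> i) = - \<alpha> j" using i(1) by blast
  qed (use ws in auto)
  then show ?thesis using w[OF i] by simp
qed

lemma star_eq:
  assumes i: "i \<in> {1..r}"
  shows "star r \<alpha> i = \<tau> i"
  unfolding star_def longest_fund_weight[OF i]
  using \<tau>_in[OF i] fund_weight_inj by (intro the_equality) auto

end

context coxeter_heights
begin

text \<open>An eigenvector of \<open>c\<close> for \<open>exp (2\<pi>\<i>/h)\<close> in the complexified dual space, with no vanishing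
  coordinate on the fundamental weights.\<close>

definition eigenform :: "'a \<Rightarrow> complex" where
  "eigenform x = (\<Sum>i\<in>{1..r}. (coroot (\<alpha> i) \<bullet> x) *\<^sub>R (v i *\<^sub>R cis (\<xi> i * (pi / h))))"

lemma linear_eigenform: "linear eigenform"
proof -
  have "linear (\<lambda>x. (u \<bullet> x) *\<^sub>R w)" for u :: 'a and w :: complex
    by (rule linearI) (simp_all add: inner_add_right scaleR_add_left)
  then show ?thesis unfolding eigenform_def by (intro linear_compose_sum ballI)
qed

lemma eigenform_fund_weight:
  assumes i: "i \<in> {1..r}"
  shows "eigenform (\<omega> i) = v i *\<^sub>R cis (\<xi> i * (pi / h))"
proof -
  have "eigenform (\<omega> i) = (\<Sum>j\<in>{1..r}. if j = i then v j *\<^sub>R cis (\<xi> j * (pi / h)) else 0)"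
    unfolding eigenform_def by (intro sum.cong) (auto simp: coroot_fund_weight[OF i])
  then show ?thesis using i by simp
qed

lemma eigenform_fund_weight_nonzero: "i \<in> {1..r} \<Longrightarrow> eigenform (\<omega> i) \<noteq> 0"
  using eigen_nonzero by (simp add: eigenform_fund_weight)

text \<open>Strong induction on the label, since \<open>mesh\<close> expresses
  \<open>c (\<omega> i)\<close> through \<open>c (\<omega> j)\<close> with j < i. With \<theta> =
  pi/h, every neighbour contributes the same phase (\<xi> i + 1) \<theta>, the weights
  \<open>v j\<close> add up by \<open>eigen\<close>, and 2 cos \<theta> cis \<theta> = 1 + cis (2
  \<theta>) splits off the term of \<omega>_i.\<close>

lemma eigenform_c: "eigenform (c x) = cis (2 * (pi / h)) * eigenform x"
proof -
  define \<theta> where "\<theta> = pi / h"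
  have *: "eigenform (c (\<omega> i)) = cis (2 * \<theta>) * eigenform (\<omega> i)" if "i \<in> {1..r}" for i
    using that
  proof (induction i rule: less_induct)
    case (less i)
    note i = less.prems
    have nb_term: "eigenform (if j < i then c (\<omega> j) else \<omega> j) = v j *\<^sub>R cis ((\<xi> i + 1) * \<theta>)"
      if j: "j \<in> nb r A i" for j
    proof -
      have jR: "j \<in> {1..r}" using j by (simp add: nb_def)
      show ?thesis
      proof (cases "j < i")
        case True
        then have "\<xi> j = \<xi> i - 1" using height_nb[OF i j] by simp
        then have "real_of_int (\<xi> j) = \<xi> i - 1" by simp
        then have eq: "2 * \<theta> + \<xi> j * \<theta> = (\<xi> i + 1) * \<theta>"
          by (simp only:) (simp add: algebra_simps)
        have "eigenform (c (\<omega> j)) = v j *\<^sub>R cis (2 * \<theta> + \<xi> j * \<theta>)"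
          unfolding less.IH[OF True jR] eigenform_fund_weight[OF jR] \<theta>_def[symmetric]
          by (simp only: mult_scaleR_right cis_mult)
        then show ?thesis using True unfolding eq by simp
      next
        case False
        then have "\<xi> j = \<xi> i + 1" using height_nb[OF i j] by simp
        then show ?thesis
          using False by (simp add: eigenform_fund_weight[OF jR] \<theta>_def[symmetric])
      qed
    qed
    have "eigenform (\<omega> i) + eigenform (c (\<omega> i)) = eigenform (\<omega> i + c (\<omega> i))"
      by (simp add: linear_add[OF linear_eigenform])
    also have "\<dots> = (\<Sum>j\<in>nb r A i. v j *\<^sub>R cis ((\<xi> i + 1) * \<theta>))"
      unfolding mesh[OF i] linear_sum[OF linear_eigenform] by (intro sum.cong) (auto simp: nb_term)
    also have "\<dots> = (2 * cos \<theta> * v i) *\<^sub>R cis ((\<xi> i + 1) * \<theta>)"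
      using eigen[OF i] by (simp add: scaleR_sum_left[symmetric] \<theta>_def)
    also have "\<dots> = v i *\<^sub>R (cis (\<xi> i * \<theta>) * (2 * cos \<theta> * cis \<theta>))"
      by (simp add: scaleR_conv_of_real cis_mult[symmetric] algebra_simps)
    also have "2 * cos \<theta> * cis \<theta> = 1 + cis (2 * \<theta>)"
      by (simp add: complex_eq_iff cos_double_cos sin_double power2_eq_square)
    finally show ?case
      by (simp add: eigenform_fund_weight[OF i] \<theta>_def[symmetric] algebra_simps)
  qed
  have "(\<lambda>x. eigenform (c x)) = (\<lambda>x. cis (2 * \<theta>) * eigenform x)"
  proof (rule linear_eq_on_fund_weights)
    show "linear (\<lambda>x. eigenform (c x))"
      using linear_compose[OF linear_c linear_eigenform] by (simp add: o_def)
    show "linear (\<lambda>x. cis (2 * \<theta>) * eigenform x)"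
      by (rule linearI) (simp_all add: linear_add[OF linear_eigenform] linear_scale[OF linear_eigenform]
          algebra_simps)
  qed (rule *)
  then show ?thesis by (simp add: \<theta>_def fun_eq_iff)
qed

text \<open>\<open>eigenform\<close> does not vanish at \<omega>_i, so fixing this single vector
  already forces the k-th power of a primitive h-th root of unity to be 1.\<close>

lemma fund_weight_period:
  assumes i: "i \<in> {1..r}" and k: "(c ^^ k) (\<omega> i) = \<omega> i"
  shows "h dvd k"
proof -
  have "eigenform ((c ^^ k) x) = cis (2 * (pi / h)) ^ k * eigenform x" for x
    by (induction k) (simp_all add: eigenform_c)
  then have "cis (2 * (pi / h)) ^ k * eigenform (\<omega> i) = eigenform (\<omega> i)" using k by metis
  then have "cis (2 * (pi / h)) ^ k = 1" using eigenform_fund_weight_nonzero[OF i] by simp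
  then have "cis (k * (2 * (pi / h))) = 1" by (simp only: Complex.DeMoivre)
  moreover have "k * (2 * (pi / h)) = 2 * pi * (k / h)" by simp
  ultimately have "cis (2 * pi * (k / h)) = 1" by (simp only:)
  then have "cos (2 * pi * (k / h)) = 1" by (simp add: complex_eq_iff)
  then obtain n :: int where "2 * pi * (k / h) = real_of_int n * 2 * pi"
    using cos_one_2pi_int by blast
  then have "real k = real_of_int n * real h" using rank_less by (simp add: field_simps)
  then have "int k = n * int h" by (metis of_int_eq_iff of_int_mult of_int_of_nat_eq)
  then show ?thesis by (metis dvd_triv_right int_dvd_int_iff)
qed

text \<open>Two half turns, of \<open>m i\<close> and \<open>m (\<tau> i)\<close> steps, bring
  \<omega>_i back after h steps; the lower bound is the period of \<omega>_1.\<close>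

lemma coxeter_number_eq:
  assumes "1 \<le> r"
  shows "coxeter_number r \<alpha> = h"
  unfolding coxeter_number_def
proof (rule Least_equality)
  have "c ^^ h = id"
  proof (rule linear_eq_on_fund_weights)
    fix i assume i: "i \<in> {1..r}"
    have "(c ^^ h) (\<omega> i) = (c ^^ m (\<tau> i)) ((c ^^ m i) (\<omega> i))"
      using m_\<tau>[OF i] by (metis add.commute comp_apply funpow_add)
    also have "\<dots> = \<omega> i"
      unfolding c_m[OF i] linear_neg[OF linear_funpow[OF linear_c]] c_m[OF \<tau>_in[OF i]] \<tau>_\<tau>[OF i]
      by simp
    finally show "(c ^^ h) (\<omega> i) = id (\<omega> i)" by simp
  next
    show "linear (c ^^ h)" by (intro linear_funpow linear_c)
    show "linear (id :: 'a \<Rightarrow> 'a)" by (simp add: linear_iff)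
  qed
  then show "0 < h \<and> c ^^ h = id" using rank_less by simp
next
  fix k assume k: "0 < k \<and> c ^^ k = id"
  then have "h dvd k" using fund_weight_period[of 1 k] assms by simp
  then show "h \<le> k" using k dvd_imp_le by blast
qed

section \<open>Descent along the orbits\<close>

text \<open>Only the letter \<open>j\<close> affects the pairing with \<omega>_j. As the letters are
  distinct, the leading reflection must act trivially and can be peeled off.\<close>

lemma word_prod_fixed:
  assumes "distinct ws" "set ws \<subseteq> {1..r}" "word_prod \<alpha> ws u = u" "i \<in> set ws"
  shows "coroot (\<alpha> i) \<bullet> u = 0"
  using assms
proof (induction ws)
  case (Cons j ws)
  define x where "x = word_prod \<alpha> ws u"
  have j: "j \<in> {1..r}" "j \<notin> set ws" "set ws \<subseteq> {1..r}" using Cons.prems by auto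
  have "word_prod \<alpha> (rev ws) (\<omega> j) = \<omega> j"
    using j by (intro word_prod_fix_fund_weight) auto
  then have \<omega>x: "\<omega> j \<bullet> x = \<omega> j \<bullet> u"
    unfolding x_def by (metis inner_word_prod_left inner_commute)
  have u: "u = x - (coroot (\<alpha> j) \<bullet> x) *\<^sub>R \<alpha> j"
    using Cons.prems(3) by (simp add: x_def refl_along_def)
  have "\<omega> j \<bullet> u = \<omega> j \<bullet> x - (coroot (\<alpha> j) \<bullet> x) * (\<omega> j \<bullet> \<alpha> j)"
    using arg_cong[OF u, of "\<lambda>y. \<omega> j \<bullet> y"] by (simp only: inner_diff_right inner_scaleR_right)
  then have "(coroot (\<alpha> j) \<bullet> x) * (\<omega> j \<bullet> \<alpha> j) = 0" using \<omega>x by linarith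
  then have "coroot (\<alpha> j) \<bullet> x = 0"
    using fund_weight_inner_simple[OF j(1) j(1)] simple_nonzero[OF j(1)] by simp
  moreover from this have "x = u" using u by simp
  ultimately show ?case using Cons j(3) by (auto simp: x_def)
qed simp

lemma c_fixed: "c u = u \<Longrightarrow> u = 0"
proof (rule eq_if_inner_simple)
  fix i assume "c u = u" and i: "i \<in> {1..r}"
  then have "coroot (\<alpha> i) \<bullet> u = 0"
    unfolding coxeter_element_def by (intro word_prod_fixed[of "[1..<Suc r]"]) auto
  then show "\<alpha> i \<bullet> u = \<alpha> i \<bullet> 0" using simple_nonzero[OF i] by (simp add: coroot_def)
qed

lemma funpow_c_word: "\<exists>ws. set ws \<subseteq> {1..r} \<and> c ^^ k = word_prod \<alpha> ws"
proof (induction k)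
  case (Suc k)
  then obtain ws where "set ws \<subseteq> {1..r}" "c ^^ k = word_prod \<alpha> ws" by blast
  then show ?case
    by (intro exI[of _ "[1..<Suc r] @ ws"]) (auto simp: coxeter_element_def)
qed (auto intro: exI[of _ "[]"])

text \<open>The orbit of the weight at \<open>\<tau> j\<close> also meets -\<omega>_j, so
  \<open>weyl_fund_weight_eq\<close> gives j = \<tau> i. Were k < m i, then \<omega>_i would return
  after m i - k steps, fewer than its period h.\<close>

lemma fund_weight_orbit_neg:
  assumes i: "i \<in> {1..r}" and j: "j \<in> {1..r}" and k: "(c ^^ k) (\<omega> i) = - \<omega> j"
  shows "m i \<le> k"
proof (rule ccontr)
  assume lt: "\<not> m i \<le> k"
  have "\<tau> i = j"
  proof -
    define j' where "j' = \<tau> j"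
    have j': "j' \<in> {1..r}" "\<tau> j' = j" using \<tau>_in[OF j] \<tau>_\<tau>[OF j] by (simp_all add: j'_def)
    obtain us where us: "set us \<subseteq> {1..r}" "c ^^ k = word_prod \<alpha> us" using funpow_c_word by blast
    obtain ws where ws: "set ws \<subseteq> {1..r}" "c ^^ m j' = word_prod \<alpha> ws" using funpow_c_word by blast
    have "word_prod \<alpha> us (\<omega> i) = word_prod \<alpha> ws (\<omega> j')" using c_m[OF j'(1)] j'(2) k us ws by simp
    then have "word_prod \<alpha> (rev ws @ us) (\<omega> i) = \<omega> j'" by simp
    moreover have "word_prod \<alpha> (rev ws @ us) \<in> W" using us ws by (intro word_prod_in_weyl) auto
    ultimately have "i = j'" using weyl_fund_weight_eq i j'(1) by blast
    then show ?thesis using j' by simp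
  qed
  then have "(c ^^ k) ((c ^^ (m i - k)) (\<omega> i)) = (c ^^ k) (\<omega> i)"
    using c_m[OF i] k lt by (metis add_diff_inverse_nat comp_apply funpow_add le_eq_less_or_eq not_le)
  then have "(c ^^ (m i - k)) (\<omega> i) = \<omega> i" by (rule funpow_c_inj)
  from fund_weight_period[OF i this] have "h \<le> m i - k" using lt by (intro dvd_imp_le) auto
  moreover have "m i < h" using m_\<tau>[OF i] m_pos[OF \<tau>_in[OF i]] by linarith
  ultimately show False using lt by linarith
qed

lemma orbit_step_root:
  assumes i: "i \<in> {1..r}"
  shows "(c ^^ k) (\<omega> i) - (c ^^ Suc k) (\<omega> i) \<in> \<Phi>"
proof -
  obtain ws where ws: "set ws \<subseteq> {1..r}" "c ^^ k = word_prod \<alpha> ws" using funpow_c_word by blast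
  have "(c ^^ k) (\<omega> i) - (c ^^ Suc k) (\<omega> i) = (c ^^ k) (\<omega> i - c (\<omega> i))"
    by (simp add: linear_diff[OF linear_funpow[OF linear_c]] funpow_swap1)
  also have "\<dots> = word_prod \<alpha> (ws @ [1..<i]) (\<alpha> i)"
    by (simp add: coxeter_fund_weight[OF i] ws)
  also have "\<dots> \<in> \<Phi>" using ws i by (intro word_prod_root simple_in) auto
  finally show ?thesis .
qed

text \<open>A positive root made negative by \<open>c\<close> is mapped to some \<open>- (\<omega> j - c (\<omega> j))\<close>; as \<open>1 - c\<close> is
  injective, the orbit of \<open>\<omega> i\<close> then meets \<open>- \<omega> j\<close>, which does not happen before \<open>m i\<close> steps.\<close>

lemma orbit_step_pos:
  assumes i: "i \<in> {1..r}" and "k < m i"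
  shows "pos ((c ^^ k) (\<omega> i) - (c ^^ Suc k) (\<omega> i))"
  using assms(2)
proof (induction k)
  case 0
  \<comment> \<open>The prefix s_1 ... s_(i-1) leaves the coefficient of \<alpha>_i unchanged, so
    the first step is a root with a positive coefficient.\<close>
  have "word_prod \<alpha> (rev [1..<i]) (\<omega> i) = \<omega> i"
    using i by (intro word_prod_fix_fund_weight) auto
  then have "\<omega> i \<bullet> (\<omega> i - c (\<omega> i)) = \<omega> i \<bullet> \<alpha> i"
    unfolding coxeter_fund_weight[OF i] by (metis inner_word_prod_left inner_commute)
  moreover have "0 < \<omega> i \<bullet> \<alpha> i"
    using simple_nonzero[OF i] by (simp add: fund_weight_inner_simple[OF i i])
  ultimately have "0 < \<omega> i \<bullet> (\<omega> i - c (\<omega> i))" by simp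
  then have "\<not> pos (- (\<omega> i - c (\<omega> i)))" using i unfolding pos_def inner_minus_right by fastforce
  then show ?case using root_pos_or_neg[OF orbit_step_root[OF i, of 0]] by simp
next
  case (Suc k)
  define \<beta> where "\<beta> = (c ^^ k) (\<omega> i) - (c ^^ Suc k) (\<omega> i)"
  have \<beta>: "\<beta> \<in> \<Phi>" "pos \<beta>"
    unfolding \<beta>_def using orbit_step_root[OF i] Suc.IH[OF Suc_lessD[OF Suc.prems]] by blast+
  have c\<beta>: "c \<beta> = (c ^^ Suc k) (\<omega> i) - (c ^^ Suc (Suc k)) (\<omega> i)"
    by (simp add: \<beta>_def linear_diff[OF linear_c])
  show ?case
  proof (rule ccontr)
    assume "\<not> ?case"
    then have neg: "\<not> pos (word_prod \<alpha> [1..<Suc r] \<beta>)" using c\<beta> by (simp add: coxeter_element_def)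
    have upt_R: "set [1..<Suc r] \<subseteq> {1..r}" by auto
    obtain as j bs where split: "[1..<Suc r] = as @ j # bs" "word_prod \<alpha> bs \<beta> = \<alpha> j"
      using inversion_prefix[OF upt_R \<beta> neg] by blast
    have j: "j \<in> {1..r}"
    proof -
      have "j \<in> set [1..<Suc r]" unfolding split(1) by simp
      then show ?thesis by auto
    qed
    \<comment> \<open>The word of \<open>c\<close> lists the labels in increasing order, so the part
      before \<open>j\<close> is the prefix occurring in \<open>coxeter_fund_weight\<close>.\<close>
    have as: "as = [1..<j]"
    proof -
      have len: "length as < Suc r - 1" using arg_cong[OF split(1), of length] by (simp del: upt_Suc)
      then have "[1..<Suc r] ! length as = 1 + length as" by (intro nth_upt) simp
      then have "j = 1 + length as" unfolding split(1) by simp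
      moreover have "as = take (length as) [1..<Suc r]" unfolding split(1) by simp
      ultimately show ?thesis using len by (metis add.commute less_diff_conv less_imp_le_nat take_upt)
    qed
    have "c \<beta> = word_prod \<alpha> as (s j (\<alpha> j))"
      using split by (simp add: coxeter_element_def del: upt_Suc)
    also have "\<dots> = - (\<omega> j - c (\<omega> j))"
      unfolding coxeter_fund_weight[OF j] as refl_along_self[OF simple_nonzero[OF j]]
      by (rule word_prod_minus)
    finally have eq: "c \<beta> = - (\<omega> j - c (\<omega> j))" .
    define u where "u = (c ^^ Suc k) (\<omega> i)"
    have "u - c u = - (\<omega> j - c (\<omega> j))" using eq unfolding c\<beta> u_def by simp
    then have "c (u + \<omega> j) = u + \<omega> j"
      unfolding linear_add[OF linear_c] by (simp add: algebra_simps)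
    then have "(c ^^ Suc k) (\<omega> i) = - \<omega> j"
      using c_fixed eq_neg_iff_add_eq_0 unfolding u_def by blast
    from fund_weight_orbit_neg[OF i j this] Suc.prems show False by simp
  qed
qed

lemma root_less_orbit:
  assumes "i \<in> {1..r}" "k < m i"
  shows "root_less r \<alpha> ((c ^^ Suc k) (\<omega> i)) ((c ^^ k) (\<omega> i))"
proof -
  note \<beta> = orbit_step_root[OF assms(1), of k]
  have "(c ^^ k) (\<omega> i) \<noteq> (c ^^ Suc k) (\<omega> i)" using root_nonzero[OF \<beta>] by (simp only: right_minus_eq) simp
  then show ?thesis
    using orbit_step_pos[OF assms] pos_iff_nonneg_comb[OF \<beta>] unfolding root_less_def by blast
qed

text \<open>Gives uniqueness for the \<open>THE\<close> in \<open>weight_chain_length\<close>: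
  \<open>pos\<close> is additive and antisymmetric, so a strictly descending chain never repeats a
  value.\<close>

lemma root_less_chain_distinct:
  assumes "\<And>k. k < n \<Longrightarrow> root_less r \<alpha> (x (Suc k)) (x k)" and "a < b" "b \<le> n"
  shows "x a \<noteq> x b"
proof -
  have "pos (x a - x b) \<and> x a - x b \<noteq> 0"
    using \<open>a < b\<close> \<open>b \<le> n\<close>
  proof (induction b rule: less_Suc_induct)
    case (1 k)
    then have "root_less r \<alpha> (x (Suc k)) (x k)" using assms(1) by simp
    then show ?case using pos_nonneg_comb by (auto simp: root_less_def)
  next
    case (2 a b d)
    then have *: "pos (x a - x b)" "x a - x b \<noteq> 0" "pos (x b - x d)" by auto
    have "x a - x d = (x a - x b) + (x b - x d)" by simp
    then have "pos (x a - x d)" using * pos_add by metis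
    moreover have "x a \<noteq> x d"
      using * pos_antisym[of "x a - x b"] by auto
    ultimately show ?case by simp
  qed
  then show ?thesis by simp
qed

lemma weight_chain_length_eq:
  assumes i: "i \<in> {1..r}"
  shows "weight_chain_length r \<alpha> i = m i"
  unfolding weight_chain_length_def Let_def star_eq[OF i]
proof (rule the_equality)
  show "1 \<le> m i \<and> (\<forall>k<m i. root_less r \<alpha> ((c ^^ Suc k) (\<omega> i)) ((c ^^ k) (\<omega> i))) \<and>
      (c ^^ m i) (\<omega> i) = - \<omega> (\<tau> i)"
    using m_pos[OF i] root_less_orbit[OF i] c_m[OF i] by blast
next
  fix n assume n: "1 \<le> n \<and> (\<forall>k<n. root_less r \<alpha> ((c ^^ Suc k) (\<omega> i)) ((c ^^ k) (\<omega> i))) \<and>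
      (c ^^ n) (\<omega> i) = - \<omega> (\<tau> i)"
  have "\<not> n < m i"
    using root_less_chain_distinct[of "m i" "\<lambda>k. (c ^^ k) (\<omega> i)" n "m i"] root_less_orbit[OF i]
      n c_m[OF i] by fastforce
  moreover have "\<not> m i < n"
    using root_less_chain_distinct[of n "\<lambda>k. (c ^^ k) (\<omega> i)" "m i" n] n c_m[OF i] by fastforce
  ultimately show "n = m i" by simp
qed

lemma a_count_minus_b_count:
  assumes i: "i \<in> {1..r}"
  shows "int (a_count r \<alpha> A i) - int (b_count r \<alpha> A i) = \<xi> (\<tau> i) - \<xi> i"
proof (cases "\<tau> i = i")
  case True
  then show ?thesis by (simp add: a_count_def b_count_def star_eq[OF i])
next
  case False
  have "dynkin_path r A i (\<tau> i) (star_path r \<alpha> A i)"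
    unfolding star_path_def star_eq[OF i] using ex1_path[OF i \<tau>_in[OF i]] by (rule theI')
  from heights_along_path(1)[where \<xi> = \<xi> and A = A and r = r, OF height sym this]
  show ?thesis using False by (simp add: a_count_def b_count_def star_eq[OF i] Let_def)
qed

end

lemma same_up_to_labelling_dynkin_tree:
  assumes "same_up_to_labelling r A B" "dynkin_tree r B h \<tau> \<rho> v"
  shows "\<exists>\<tau> \<rho> v. dynkin_tree r A h \<tau> \<rho> v"
  using assms dynkin_tree_relabel unfolding same_up_to_labelling_def by blast

theorem lemma7p24:
  fixes \<Phi> :: "'a::euclidean_space set"
    and \<alpha> :: "nat \<Rightarrow> 'a"
    and r :: nat
    and A :: "nat \<Rightarrow> nat \<Rightarrow> int"
  assumes "root_system \<Phi>"
    and "simple_system \<Phi> r \<alpha>"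
    and "cartan_matrix_of r \<alpha> A"
    and "(\<exists>n\<ge>2. type_A n r A) \<or> (\<exists>n\<ge>2. type_D (2 * n + 1) r A) \<or> type_E6 r A"
  shows "\<forall>i\<in>{1..r}. real (weight_chain_length r \<alpha> i) =
           (real (coxeter_number r \<alpha>) + real (a_count r \<alpha> A i) - real (b_count r \<alpha> A i)) / 2"
proof
  fix i assume i: "i \<in> {1..r}"
  have "\<exists>h \<tau> \<rho> v. dynkin_tree r A h \<tau> \<rho> v"
    using assms(4)
  proof (elim disjE exE conjE)
    fix n :: nat assume "type_A n r A"
    then show ?thesis
      using same_up_to_labelling_dynkin_tree dynkin_tree_A unfolding type_A_def by blast
  next
    fix n :: nat assume n: "2 \<le> n" and D: "type_D (2 * n + 1) r A"
    \<comment> \<open>The odd rank 2 n + 1 makes the branch node N odd, the parity needed by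
      \<open>dynkin_tree_D\<close>.\<close>
    define N where "N = 2 * n - 1"
    have N: "odd N" "2 \<le> N" "2 * n + 1 = N + 2" using n by (auto simp: N_def)
    show ?thesis
      using D dynkin_tree_D[OF N(1,2)] same_up_to_labelling_dynkin_tree
      unfolding type_D_def N(3) by blast
  next
    assume "type_E6 r A"
    then show ?thesis
      using same_up_to_labelling_dynkin_tree dynkin_tree_E6 unfolding type_E6_def by blast
  qed
  then obtain h \<tau> \<rho> v where tree: "dynkin_tree r A h \<tau> \<rho> v" by blast
  then obtain \<xi> :: "nat \<Rightarrow> int" where
    \<xi>: "\<forall>i\<in>{1..r}. \<forall>j\<in>nb r A i. i < j \<longrightarrow> \<xi> j = \<xi> i + 1"
    using dynkin_tree.ex_heights by blast
  interpret coxeter_heights \<Phi> r \<alpha> A h \<tau> \<rho> v \<xi>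
    using assms(1-3) tree \<xi>
    by (intro coxeter_heights.intro based_root_system.intro coxeter_heights_axioms.intro) auto
  have "2 * int (weight_chain_length r \<alpha> i) =
      int (coxeter_number r \<alpha>) + int (a_count r \<alpha> A i) - int (b_count r \<alpha> A i)"
    using m_eq[OF i] a_count_minus_b_count[OF i] coxeter_number_eq i
    by (simp add: weight_chain_length_eq[OF i])
  then have "real_of_int (2 * int (weight_chain_length r \<alpha> i)) =
      real_of_int (int (coxeter_number r \<alpha>) + int (a_count r \<alpha> A i) - int (b_count r \<alpha> A i))"
    by (simp only:)
  then show "real (weight_chain_length r \<alpha> i) =
      (real (coxeter_number r \<alpha>) + real (a_count r \<alpha> A i) - real (b_count r \<alpha> A i)) / 2"
    by simp
qed

end
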